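(* Let $P_{24}:\mathbf{R}^{24}\to\mathbf{R}$ be the cubic form $P_{24}(x)=\mathrm{Re}((o_1\cdot o_2)\cdot o_3)$, where $x=(o_1,o_2,o_3)\in\mathcal{O}^3=\mathbf{R}^{24}$. Let $1\le\delta<2$ and let $H'\subset\mathbf{R}^{24}$ be any linear subspace with $\dim H'=21$, identified with $\mathbf{R}^{21}$ by a linear isometry. Then the function $w=\big(P_{24}(x)/|x|^{\delta}\big)|_{H'}$ is a viscosity solution, in the unit ball $B\subset\mathbf{R}^{21}$, of a uniformly elliptic Isaacs equation, i.e. of an equation of the form $\sup_b\inf_a L_{ab}u=0$, where $\{L_{ab}\}$ is a two-parameter family of linear operators $L_{ab}=\sum_{i,j}a_{ij}\,\partial^2/\partial x_i\partial x_j$ whose symmetric coefficient matrices $(a_{ij})$ all satisfy $C^{-1}|\xi|^2\le\sum a_{ij}\xi_i\xi_j\le C|\xi|^2$ for all $\xi$, for one fixed constant $C>0$.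
   Context: $\mathcal{O}$ denotes the algebra of Cayley octonions: the 8-dimensional real algebra with basis $1,e_1,\dots,e_7$, where $1$ is the unit, $e_i^2=-1$, $e_ie_j=-e_je_i$ for $i\neq j$, and for every $i$ (indices mod 7) $e_ie_{i+1}=e_{i+3}$, $e_{i+1}e_{i+3}=e_i$, $e_{i+3}e_i=e_{i+1}$ (so $e_1e_2=e_4$). $\mathbf{R}^8$ is identified with $\mathcal{O}$ via $t\mapsto t_0+t_1e_1+\dots+t_7e_7$; $\mathrm{Re}$ denotes the coefficient of $1$. Octonion multiplication satisfies $\mathrm{Re}((o_1o_2)o_3)=\mathrm{Re}(o_1(o_2o_3))$. Viscosity solutions are in the standard sense. *)

theory Defs
  imports "HOL-Analysis.Analysis"
begin

text \<open>Octonions as coefficient functions on indices 0..7 (index 0 is the unit 1,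
  index i (1 \<le> i \<le> 7) is e_i).  Indices mod 7 are represented by 1..7.\<close>

definition om :: "nat \<Rightarrow> nat" where
  "om r = (if r mod 7 = 0 then 7 else r mod 7)"

definition oct_triples :: "(nat \<times> nat \<times> nat) set" where
  "oct_triples = (\<Union>t\<in>{..<7}.
     {(om t, om (t+1), om (t+3)), (om (t+1), om (t+3), om t), (om (t+3), om t, om (t+1))})"

text \<open>Structure constants: e_i e_j = sum_k oct_c i j k e_k.\<close>
definition oct_c :: "nat \<Rightarrow> nat \<Rightarrow> nat \<Rightarrow> real" where
  "oct_c i j k =
    (if i = 0 then (if j = k then 1 else 0)
     else if j = 0 then (if i = k then 1 else 0)
     else if i = j then (if k = 0 then -1 else 0)
     else if (i, j, k) \<in> oct_triples then 1
     else if (j, i, k) \<in> oct_triples then -1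
     else 0)"

definition oct_mul :: "(nat \<Rightarrow> real) \<Rightarrow> (nat \<Rightarrow> real) \<Rightarrow> (nat \<Rightarrow> real)" where
  "oct_mul a b = (\<lambda>k. \<Sum>i<8. \<Sum>j<8. a i * b j * oct_c i j k)"

definition oct_Re :: "(nat \<Rightarrow> real) \<Rightarrow> real" where
  "oct_Re a = a 0"

definition oct_block :: "real^24 \<Rightarrow> nat \<Rightarrow> (nat \<Rightarrow> real)" where
  "oct_block x m = (\<lambda>k. x $ (of_nat (8 * m + k) :: 24))"

definition P24 :: "real^24 \<Rightarrow> real" where
  "P24 x = oct_Re (oct_mul (oct_mul (oct_block x 0) (oct_block x 1)) (oct_block x 2))"

definition C2_test_at :: "('n::finite) itself \<Rightarrow> (real^'n \<Rightarrow> real) \<Rightarrow> real^'n \<Rightarrow> real^'n^'n \<Rightarrow> bool" where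
  "C2_test_at _ \<phi> x0 H \<longleftrightarrow>
     (\<exists>U grad hess. open U \<and> x0 \<in> U \<and>
        (\<forall>x\<in>U. (\<phi> has_derivative (\<lambda>h. grad x \<bullet> h)) (at x)) \<and>
        (\<forall>x\<in>U. (grad has_derivative (\<lambda>h. hess x *v h)) (at x)) \<and>
        continuous_on U hess \<and> hess x0 = H)"

definition viscosity_solution ::
    "(real^'n^'n \<Rightarrow> real) \<Rightarrow> (real^'n::finite \<Rightarrow> real) \<Rightarrow> (real^'n) set \<Rightarrow> bool" where
  "viscosity_solution F u \<Omega> \<longleftrightarrow>
     continuous_on \<Omega> u \<and>
     (\<forall>x0\<in>\<Omega>. \<forall>\<phi> H. C2_test_at TYPE('n) \<phi> x0 H \<longrightarrow>
        (\<exists>e>0. \<forall>x\<in>\<Omega> \<inter> ball x0 e. u x - \<phi> x \<le> u x0 - \<phi> x0) \<longrightarrow> F H \<ge> 0) \<and>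
     (\<forall>x0\<in>\<Omega>. \<forall>\<phi> H. C2_test_at TYPE('n) \<phi> x0 H \<longrightarrow>
        (\<exists>e>0. \<forall>x\<in>\<Omega> \<inter> ball x0 e. u x - \<phi> x \<ge> u x0 - \<phi> x0) \<longrightarrow> F H \<le> 0)"

definition lin_op :: "real^'n^'n \<Rightarrow> real^'n^'n \<Rightarrow> real" where
  "lin_op A M = (\<Sum>i\<in>UNIV. \<Sum>j\<in>UNIV. A $ i $ j * M $ i $ j)"

definition unif_elliptic :: "real \<Rightarrow> real^'n^'n \<Rightarrow> bool" where
  "unif_elliptic C A \<longleftrightarrow> transpose A = A \<and>
     (\<forall>\<xi>. (1 / C) * (norm \<xi>)\<^sup>2 \<le> \<xi> \<bullet> (A *v \<xi>) \<and> \<xi> \<bullet> (A *v \<xi>) \<le> C * (norm \<xi>)\<^sup>2)"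

end

theory Submission
  imports Defs
begin

text \<open>
  The product a * b = conj (a b) of octonions satisfies |a * b| = |a| |b|, and (a * b) . c is
  invariant under cyclic permutations; nothing else about octonions is used. With it, P is
  (x1 * x2) . x3. For z = (z1, z2, z3) let l(z) be the largest root of l^3 - |z|^2 l + 2 P(z), which
  is the determinant of the element l + z of the Albert algebra. Two facts carry the proof.

  (1) The Hessian of P at z has the eigenvalue l(z) with multiplicity at least 6, so every subspace of
  codimension 5 contains a unit vector on which it is at least l(z).

  (2) G(x) = P(x) / |x|^2 satisfies 2 (G(x) - G(y)) \<le> l(x - y): the gradient of 2 G at a unit vector x
  pairs with z like the square of the adjoint of x pairs with - z in the Albert algebra.

  The Hessian of w at x is |x|^(-\<delta>) M(x) with M odd and homogeneous of degree one, and on the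
  orthogonal complement of x the form M(x) is the Hessian of P minus \<delta> G(x) times the identity. Hence
  M(x) - M(y) is at least l(x - y) - \<delta> (G(x) - G(y)) \<ge> (1 - \<delta> / 2) l(x - y) on some unit vector of H'
  orthogonal to x and y, and its trace is comparably bounded. By separation of convex sets, any two
  of the forms M(x), M(y) are then annihilated by a common uniformly elliptic coefficient matrix,
  which makes the sup-inf over the matrices annihilating each M(x) vanish at every M(y). At the
  origin, oddness of w forces the Hessian of a touching test function to be semidefinite.
\<close>

section \<open>Isaacs operators vanishing on a family of matrices\<close>

lemma lin_op_add_left: "lin_op (A + B) M = lin_op A M + lin_op B M"
  by (simp add: lin_op_def sum.distrib distrib_right)

lemma lin_op_scaleR_left: "lin_op (c *\<^sub>R A) M = c * lin_op A M"
  by (simp add: lin_op_def sum_distrib_left mult.assoc)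

lemma lin_op_add_right: "lin_op A (M + N) = lin_op A M + lin_op A N"
  by (simp add: lin_op_def sum.distrib distrib_left)

lemma lin_op_scaleR_right: "lin_op A (c *\<^sub>R M) = c * lin_op A M"
  by (simp add: lin_op_def sum_distrib_left mult.left_commute)

lemma lin_op_diff_right: "lin_op A (M - N) = lin_op A M - lin_op A N"
  by (simp add: lin_op_def sum_subtractf right_diff_distrib)

lemma lin_op_mat_1: "lin_op (mat 1) M = trace M"
proof -
  have "(\<Sum>j\<in>UNIV. mat 1 $ i $ j * M $ i $ j) = M $ i $ i" for i
    by (simp add: mat_def if_distrib[of "\<lambda>c. c * _"] sum.delta cong: if_cong)
  then show ?thesis by (simp add: lin_op_def trace_def)
qed

definition outer :: "real^'n \<Rightarrow> real^'n^'n" where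
  "outer \<eta> = (\<chi> i j. \<eta> $ i * \<eta> $ j)"

lemma lin_op_outer: "lin_op (outer \<eta>) M = \<eta> \<bullet> (M *v \<eta>)"
  by (simp add: lin_op_def outer_def inner_vec_def matrix_vector_mult_def sum_distrib_left algebra_simps)

lemma outer_mult: "outer \<eta> *v \<xi> = (\<eta> \<bullet> \<xi>) *\<^sub>R \<eta>"
  by (simp add: vec_eq_iff outer_def inner_vec_def matrix_vector_mult_def sum_distrib_left algebra_simps)

section \<open>Density matrices and uniformly elliptic coefficient matrices\<close>

text \<open>By the spectral theorem these are the positive semidefinite symmetric matrices of trace
  one. As a convex hull of rank-one projections, the set is visibly compact, and convex conditions
  can be tested on the generators.\<close>

definition densities :: "(real^'n^'n) set" where
  "densities = convex hull (outer ` sphere 0 1)"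

lemma compact_densities: "compact (densities :: (real^'n^'n) set)"
proof -
  have "continuous_on (sphere 0 1) (outer :: real^'n \<Rightarrow> _)"
    unfolding outer_def by (intro continuous_intros)
  then show ?thesis
    unfolding densities_def by (intro compact_convex_hull compact_continuous_image compact_sphere)
qed

lemma densities_lin_op_nonneg:
  assumes "B \<in> densities" "\<And>\<eta>. 0 \<le> \<eta> \<bullet> (M *v \<eta>)"
  shows "0 \<le> lin_op B M"
proof -
  have "convex {B. 0 \<le> lin_op B M}"
    by (auto simp: convex_alt lin_op_add_left lin_op_scaleR_left)
  moreover have "outer ` sphere 0 1 \<subseteq> {B. 0 \<le> lin_op B M}"
    using assms(2) by (auto simp: lin_op_outer)
  ultimately have "densities \<subseteq> {B. 0 \<le> lin_op B M}"
    unfolding densities_def by (rule hull_minimal[rotated])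
  then show ?thesis using assms(1) by auto
qed

text \<open>Each of the three conditions is convex in \<open>B\<close>, so rank-one generators
  decide; for them the upper bound is Cauchy-Schwarz.\<close>

lemma densities_symmetric_bounded:
  fixes B :: "real^'n^'n"
  assumes "B \<in> densities"
  shows "transpose B = B \<and> 0 \<le> \<xi> \<bullet> (B *v \<xi>) \<and> \<xi> \<bullet> (B *v \<xi>) \<le> (norm \<xi>)\<^sup>2"
proof -
  let ?S = "{B :: real^'n^'n. transpose B = B \<and> 0 \<le> \<xi> \<bullet> (B *v \<xi>) \<and> \<xi> \<bullet> (B *v \<xi>) \<le> (norm \<xi>)\<^sup>2}"
  have "convex ?S"
  proof -
    have "(1 - u) * a + u * b \<le> c" if "0 \<le> u" "u \<le> 1" "a \<le> c" "b \<le> c" for u a b c :: real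
      using convex_bound_le[OF that(3,4), of "1 - u" u] that by simp
    then show ?thesis
      by (auto simp: convex_alt matrix_vector_mult_add_rdistrib scaleR_matrix_vector_assoc[symmetric]
          inner_add_right transpose_def vec_eq_iff)
  qed
  moreover have "outer \<eta> \<in> ?S" if "norm \<eta> = 1" for \<eta> :: "real^'n"
  proof -
    have "\<xi> \<bullet> (outer \<eta> *v \<xi>) = (\<eta> \<bullet> \<xi>)\<^sup>2"
      by (simp add: outer_mult inner_commute power2_eq_square)
    moreover have "(\<eta> \<bullet> \<xi>)\<^sup>2 \<le> (norm \<xi>)\<^sup>2"
      using Cauchy_Schwarz_ineq[of \<eta> \<xi>] that by (simp add: dot_square_norm)
    ultimately show ?thesis
      by (simp add: outer_def transpose_def vec_eq_iff mult.commute)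
  qed
  ultimately have "densities \<subseteq> ?S"
    unfolding densities_def by (intro hull_minimal) auto
  then show ?thesis using assms by auto
qed

text \<open>The identity secures the lower ellipticity bound, the density matrix is free to be
  adapted to given Hessians, and \<open>c\<close> limits its influence.\<close>

definition elliptic_coeffs :: "real \<Rightarrow> (real^'n^'n) set" where
  "elliptic_coeffs c = (\<lambda>B. mat 1 + c *\<^sub>R B) ` densities"

lemma elliptic_coeffs_unif_elliptic:
  assumes "c \<ge> 0" "A \<in> elliptic_coeffs c"
  shows "unif_elliptic (1 + c) A"
proof -
  obtain B where B: "B \<in> densities" and A: "A = mat 1 + c *\<^sub>R B"
    using assms by (auto simp: elliptic_coeffs_def)
  note d = densities_symmetric_bounded[OF B]
  have tr: "transpose A = A"
    using d[of 0] by (simp add: A transpose_def vec_eq_iff mat_def)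
  have q: "\<xi> \<bullet> (A *v \<xi>) = (norm \<xi>)\<^sup>2 + c * (\<xi> \<bullet> (B *v \<xi>))" for \<xi>
    by (simp add: A matrix_vector_mult_add_rdistrib scaleR_matrix_vector_assoc[symmetric]
        inner_add_right power2_norm_eq_inner)
  have "1 / (1 + c) * (norm \<xi>)\<^sup>2 \<le> \<xi> \<bullet> (A *v \<xi>)" for \<xi>
  proof -
    have "1 / (1 + c) * (norm \<xi>)\<^sup>2 \<le> 1 * (norm \<xi>)\<^sup>2"
      using assms(1) by (intro mult_right_mono) auto
    moreover have "0 \<le> c * (\<xi> \<bullet> (B *v \<xi>))" using d[of \<xi>] assms(1) by simp
    ultimately show ?thesis unfolding q by linarith
  qed
  moreover have "\<xi> \<bullet> (A *v \<xi>) \<le> (1 + c) * (norm \<xi>)\<^sup>2" for \<xi>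
    using mult_left_mono[of "\<xi> \<bullet> (B *v \<xi>)" "(norm \<xi>)\<^sup>2" c] d[of \<xi>] assms(1)
    by (simp add: q algebra_simps)
  ultimately show ?thesis using tr by (simp add: unif_elliptic_def)
qed

lemma elliptic_coeffs_lin_op_nonneg:
  fixes A :: "real^'n^'n"
  assumes "c \<ge> 0" "A \<in> elliptic_coeffs c" "\<And>\<eta>. 0 \<le> \<eta> \<bullet> (M *v \<eta>)"
  shows "0 \<le> lin_op A M"
proof -
  obtain B where B: "B \<in> densities" and A: "A = mat 1 + c *\<^sub>R B"
    using assms by (auto simp: elliptic_coeffs_def)
  have "M $ i $ i = axis i 1 \<bullet> (M *v axis i 1)" for i
    by (simp add: inner_axis' matrix_vector_mult_basis column_def)
  then have "0 \<le> trace M"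
    unfolding trace_def by (intro sum_nonneg) (simp add: assms(3))
  then show ?thesis
    using densities_lin_op_nonneg[OF B assms(3)] assms(1)
    by (simp add: A lin_op_add_left lin_op_scaleR_left lin_op_mat_1)
qed

lemma elliptic_coeffs_lin_op_mono:
  fixes A :: "real^'n^'n"
  assumes "c \<ge> 0" "A \<in> elliptic_coeffs c" "\<And>\<eta>. \<eta> \<bullet> (M *v \<eta>) \<le> \<eta> \<bullet> (N *v \<eta>)"
  shows "lin_op A M \<le> lin_op A N"
  using elliptic_coeffs_lin_op_nonneg[OF assms(1,2), of "N - M"] assms(3)
  by (simp add: lin_op_diff_right matrix_vector_mult_diff_rdistrib inner_diff_right)

text \<open>Compactness of the coefficient set; it supplies the boundedness without which real
  \<open>INF\<close> and \<open>SUP\<close> cannot be compared with their elements.\<close>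

lemma elliptic_coeffs_lin_op_bounded:
  fixes M :: "real^'n^'n"
  obtains K where "\<And>A. A \<in> elliptic_coeffs c \<Longrightarrow> \<bar>lin_op A M\<bar> \<le> K"
proof -
  have "compact (elliptic_coeffs c :: (real^'n^'n) set)"
    unfolding elliptic_coeffs_def by (intro compact_continuous_image continuous_intros compact_densities)
  moreover have "continuous_on (elliptic_coeffs c) (\<lambda>A. lin_op A M)"
    unfolding lin_op_def by (intro continuous_intros)
  ultimately have "bounded ((\<lambda>A. lin_op A M) ` elliptic_coeffs c)"
    by (intro compact_imp_bounded compact_continuous_image)
  then show ?thesis using that unfolding bounded_iff by (metis imageI real_norm_def)
qed

section \<open>Separation argument and construction of the Isaacs operator\<close>

text \<open>Separation in the plane: the pairs \<open>f B\<close> for density matrices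
  \<open>B\<close> fill a compact convex set. If it missed \<open>p\<close>, a separating functional
  would yield a combination of \<open>M\<close> and \<open>N\<close> violating the hypothesis at
  every unit vector.\<close>

lemma common_annihilator:
  fixes M N :: "real^'n^'n"
  assumes c: "c > 0"
    and *: "\<And>a b. \<exists>\<eta>. norm \<eta> = 1 \<and>
      \<bar>trace (a *\<^sub>R M + b *\<^sub>R N)\<bar> \<le> c * (\<eta> \<bullet> ((a *\<^sub>R M + b *\<^sub>R N) *v \<eta>))"
  obtains A where "A \<in> elliptic_coeffs c" "lin_op A M = 0" "lin_op A N = 0"
proof -
  define f where "f B = (lin_op B M, lin_op B N)" for B
  \<comment> \<open>\<open>lin_op (mat 1 + c *\<^sub>R B) M\<close> equals
    \<open>trace M + c * lin_op B M\<close>, so \<open>f B = p\<close> says that both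
    \<open>M\<close> and \<open>N\<close> are annihilated.\<close>
  define p where "p = (- trace M / c, - trace N / c)"
  have "linear f"
    by (rule linearI) (simp_all add: f_def lin_op_add_left lin_op_scaleR_left)
  have "p \<in> f ` densities"
  proof (rule ccontr)
    assume "p \<notin> f ` densities"
    moreover have "convex (f ` densities)"
      unfolding densities_def by (rule convex_linear_image[OF \<open>linear f\<close> convex_convex_hull])
    moreover have "closed (f ` densities)"
      using compact_densities linear_continuous_on[OF linear_conv_bounded_linear[THEN iffD1, OF \<open>linear f\<close>]]
      by (intro compact_imp_closed compact_continuous_image) auto
    ultimately obtain u k where uk: "u \<bullet> p < k" "\<And>q. q \<in> f ` densities \<Longrightarrow> k < u \<bullet> q"
      using separating_hyperplane_closed_point[of "f ` densities" p] by metis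
    \<comment> \<open>With these signs, \<open>u \<bullet> p\<close> is the trace of
      \<open>a *\<^sub>R M + b *\<^sub>R N\<close> over \<open>c\<close>, and
      \<open>u \<bullet> f (outer \<eta>)\<close> is minus its quadratic form at
      \<open>\<eta>\<close>.\<close>
    obtain a b where u: "u = (- a, - b)" by (metis minus_equation_iff surj_pair)
    obtain \<eta> where \<eta>: "norm \<eta> = 1"
      "\<bar>trace (a *\<^sub>R M + b *\<^sub>R N)\<bar> \<le> c * (\<eta> \<bullet> ((a *\<^sub>R M + b *\<^sub>R N) *v \<eta>))"
      using * by blast
    have "outer \<eta> \<in> densities"
      using \<eta>(1) unfolding densities_def by (intro hull_inc) auto
    then have "u \<bullet> p < u \<bullet> f (outer \<eta>)" using uk by fastforce
    then have "trace (a *\<^sub>R M + b *\<^sub>R N) / c < - (\<eta> \<bullet> ((a *\<^sub>R M + b *\<^sub>R N) *v \<eta>))"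
      by (simp add: u p_def f_def lin_op_outer matrix_vector_mult_add_rdistrib
          scaleR_matrix_vector_assoc[symmetric] inner_add_right lin_op_mat_1[symmetric]
          lin_op_add_right lin_op_scaleR_right add_divide_distrib)
    then have "trace (a *\<^sub>R M + b *\<^sub>R N) < - (c * (\<eta> \<bullet> ((a *\<^sub>R M + b *\<^sub>R N) *v \<eta>)))"
      using c by (simp add: field_simps)
    then show False using \<eta>(2) by linarith
  qed
  then obtain B where "B \<in> densities" "f B = p" by auto
  then show ?thesis
    using that[of "mat 1 + c *\<^sub>R B"] c
    by (auto simp: elliptic_coeffs_def f_def p_def lin_op_add_left lin_op_scaleR_left lin_op_mat_1)
qed

text \<open>The index \<open>b\<close> runs over the annihilators of the members of
  \<open>K\<close>, and the inner infimum is over the matrices in \<open>b\<close>. If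
  \<open>H\<close> lies above \<open>M\<close>, the index \<open>ann M\<close> gives a nonnegative
  infimum. If \<open>H\<close> lies below \<open>M\<close>, every index contains a matrix that also
  annihilates \<open>M\<close>, so every infimum is at most zero. Both halves use that elliptic
  operators are monotone.\<close>

lemma isaacs_operator_exists:
  fixes K :: "(real^'n^'n) set"
  assumes c: "c > 0" and K: "K \<noteq> {}"
    and *: "\<And>M N a b. M \<in> K \<Longrightarrow> N \<in> K \<Longrightarrow> \<exists>\<eta>. norm \<eta> = 1 \<and>
      \<bar>trace (a *\<^sub>R M + b *\<^sub>R N)\<bar> \<le> c * (\<eta> \<bullet> ((a *\<^sub>R M + b *\<^sub>R N) *v \<eta>))"
  obtains C and Bs :: "(real^'n^'n) set set" and As :: "(real^'n^'n) set"
    and Lab :: "(real^'n^'n) set \<Rightarrow> real^'n^'n \<Rightarrow> real^'n^'n"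
  where "C > 0" "Bs \<noteq> {}" "As \<noteq> {}" "\<forall>b\<in>Bs. \<forall>a\<in>As. unif_elliptic C (Lab b a)"
    "\<forall>M\<in>K. \<forall>H. (\<forall>\<eta>. \<eta> \<bullet> (M *v \<eta>) \<le> \<eta> \<bullet> (H *v \<eta>))
      \<longrightarrow> 0 \<le> (SUP b\<in>Bs. INF a\<in>As. lin_op (Lab b a) H)"
    "\<forall>M\<in>K. \<forall>H. (\<forall>\<eta>. \<eta> \<bullet> (H *v \<eta>) \<le> \<eta> \<bullet> (M *v \<eta>))
      \<longrightarrow> (SUP b\<in>Bs. INF a\<in>As. lin_op (Lab b a) H) \<le> 0"
proof -
  define ann where "ann M = {A \<in> elliptic_coeffs c. lin_op A M = 0}" for M :: "real^'n^'n"
  \<comment> \<open>The index set of a may not depend on b, so indices outside b are sent to some element of b.\<close>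
  define Lab :: "(real^'n^'n) set \<Rightarrow> real^'n^'n \<Rightarrow> real^'n^'n"
    where "Lab b a = (if a \<in> b then a else (SOME a. a \<in> b))" for a b
  have common: "\<exists>A \<in> ann N. lin_op A M = 0" if "M \<in> K" "N \<in> K" for M N
    using common_annihilator[OF c *[OF that]] by (auto simp: ann_def)
  have Lab: "Lab (ann M) a \<in> ann M" if "M \<in> K" for M a
    using common[OF that that] someI_ex[of "\<lambda>a. a \<in> ann M"] by (auto simp: Lab_def)
  have sub: "ann M \<subseteq> elliptic_coeffs c" for M by (auto simp: ann_def)
  have ne: "elliptic_coeffs c \<noteq> ({} :: (real^'n^'n) set)" using K Lab sub by fastforce
  let ?I = "\<lambda>b H. INF a\<in>elliptic_coeffs c. lin_op (Lab b a) H"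
  let ?F = "\<lambda>H. SUP b\<in>ann ` K. ?I b H"
  have bdd: "bdd_below ((\<lambda>a. lin_op (Lab (ann M) a) H) ` elliptic_coeffs c)" if "M \<in> K" for M H
  proof -
    obtain k where "\<And>A. A \<in> elliptic_coeffs c \<Longrightarrow> \<bar>lin_op A H\<bar> \<le> k"
      using elliptic_coeffs_lin_op_bounded[of c H] by metis
    then show ?thesis
      using Lab[OF that] sub by (intro bdd_belowI2[of _ "- k"]) (meson abs_le_D2 minus_le_iff subsetD)
  qed
  have I_le: "?I (ann M) H \<le> lin_op A H" if "M \<in> K" "A \<in> ann M" for M A H
    using cINF_lower[OF bdd[OF that(1)], of A H] that(2) sub by (auto simp: Lab_def)
  have bdd': "bdd_above ((\<lambda>b. ?I b H) ` ann ` K)" for H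
  proof -
    obtain k where k: "\<And>A. A \<in> elliptic_coeffs c \<Longrightarrow> \<bar>lin_op A H\<bar> \<le> k"
      using elliptic_coeffs_lin_op_bounded[of c H] by metis
    have "?I (ann M) H \<le> k" if "M \<in> K" for M
      using I_le[OF that Lab[OF that]] k sub Lab[OF that] by (meson abs_le_D1 order_trans subsetD)
    then show ?thesis by (intro bdd_aboveI[of _ k]) auto
  qed
  show ?thesis
  proof (rule that[of "1 + c" "ann ` K" "elliptic_coeffs c" Lab]; (intro ballI allI impI)?)
    fix M H assume M: "M \<in> K"
    show "0 \<le> ?F H" if "\<forall>\<eta>. \<eta> \<bullet> (M *v \<eta>) \<le> \<eta> \<bullet> (H *v \<eta>)"
    proof -
      have "0 \<le> lin_op (Lab (ann M) a) H" for a
        using elliptic_coeffs_lin_op_mono[of c "Lab (ann M) a" M H] that Lab[OF M, of a] c by (simp add: ann_def)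
      then have "0 \<le> ?I (ann M) H" by (intro cINF_greatest[OF ne])
      also have "\<dots> \<le> ?F H" by (rule cSUP_upper[OF _ bdd']) (use M in simp)
      finally show ?thesis .
    qed
    show "?F H \<le> 0" if H: "\<forall>\<eta>. \<eta> \<bullet> (H *v \<eta>) \<le> \<eta> \<bullet> (M *v \<eta>)"
    proof (rule cSUP_least)
      fix b assume "b \<in> ann ` K"
      then obtain N where N: "N \<in> K" "b = ann N" by auto
      obtain A where A: "A \<in> ann N" "lin_op A M = 0" using common[OF M N(1)] by blast
      then have "lin_op A H \<le> 0"
        using elliptic_coeffs_lin_op_mono[of c A H M] H c by (simp add: ann_def)
      then show "?I b H \<le> 0" unfolding N(2) using I_le[OF N(1) A(1), of H] by (rule order_trans[rotated])
    qed (use K in simp)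
  next
    show "unif_elliptic (1 + c) (Lab b a)" if "b \<in> ann ` K" for a b
      using that Lab sub c by (auto intro!: elliptic_coeffs_unif_elliptic)
  qed (use c K ne in auto)
qed

section \<open>Second differences and viscosity solutions\<close>

text \<open>One use of l'Hopital's rule leaves \<open>(f' t - f' (- t)) / (2 * t)\<close>, the mean
  of two difference quotients of \<open>f'\<close> at 0, taken from the right and from the
  left.\<close>

lemma second_difference_limit:
  fixes f f' :: "real \<Rightarrow> real"
  assumes f: "\<forall>\<^sub>F t in nhds 0. (f has_real_derivative f' t) (at t)"
    and f': "(f' has_real_derivative d) (at 0)"
  shows "((\<lambda>t. (f t + f (- t) - 2 * f 0) / t\<^sup>2) \<longlongrightarrow> d) (at_right 0)"
proof (rule lhopital_right_0[where f' = "\<lambda>t. f' t - f' (- t)" and g' = "\<lambda>t. 2 * t"])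
  obtain e where e: "e > 0" "\<And>t. \<bar>t\<bar> < e \<Longrightarrow> (f has_real_derivative f' t) (at t)"
    using f unfolding eventually_nhds_metric by (auto simp: dist_real_def)
  have c: "isCont f 0" using e(2)[of 0] e(1) by (auto intro: DERIV_isCont)
  then have "((\<lambda>t. f t) \<longlongrightarrow> f 0) (at_right 0)"
    by (simp add: isCont_def filterlim_at_split)
  moreover have "((\<lambda>t. f (- t)) \<longlongrightarrow> f 0) (at_right 0)"
    using c by (simp add: isCont_def filterlim_at_split filterlim_at_left_to_right)
  ultimately show "((\<lambda>t. f t + f (- t) - 2 * f 0) \<longlongrightarrow> 0) (at_right 0)"
    by (auto intro!: tendsto_eq_intros)
  show "((\<lambda>t. t\<^sup>2) \<longlongrightarrow> 0) (at_right (0::real))" by (auto intro!: tendsto_eq_intros)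
  show "\<forall>\<^sub>F t in at_right 0. t\<^sup>2 \<noteq> (0::real)" "\<forall>\<^sub>F t in at_right 0. 2 * t \<noteq> (0::real)"
    by (auto simp: eventually_at_filter)
  have ev: "\<forall>\<^sub>F t in at_right 0. \<bar>t\<bar> < e"
    using e(1) unfolding eventually_at_right_field by (intro exI[of _ e]) auto
  then show "\<forall>\<^sub>F t in at_right 0. ((\<lambda>t. f t + f (- t) - 2 * f 0) has_real_derivative f' t - f' (- t)) (at t)"
  proof eventually_elim
    case (elim t)
    have "((\<lambda>t. f (- t)) has_real_derivative f' (- t) * (- 1)) (at t)"
      using e(2)[of "- t"] elim by (intro DERIV_chain2[where g = uminus]) (auto intro!: derivative_eq_intros)
    then show ?case using e(2)[OF elim] by (auto intro!: derivative_eq_intros)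
  qed
  show "\<forall>\<^sub>F t in at_right 0. ((\<lambda>t. t\<^sup>2) has_real_derivative 2 * t) (at (t::real))"
    by (auto intro!: always_eventually derivative_eq_intros)
  have q: "((\<lambda>t. (f' t - f' 0) / t) \<longlongrightarrow> d) (at 0)"
    using f' by (simp add: has_field_derivative_iff)
  then have "((\<lambda>t. (f' t - f' 0) / t) \<longlongrightarrow> d) (at_right 0)"
    by (simp add: filterlim_at_split)
  moreover have "((\<lambda>t. (f' (- t) - f' 0) / (- t)) \<longlongrightarrow> d) (at_right 0)"
    using q by (simp add: filterlim_at_split filterlim_at_left_to_right)
  ultimately have "((\<lambda>t. ((f' t - f' 0) / t + (f' (- t) - f' 0) / (- t)) / 2) \<longlongrightarrow> (d + d) / 2) (at_right 0)"
    by (intro tendsto_intros) auto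
  then have "((\<lambda>t. (f' t - f' (- t)) / (2 * t)) \<longlongrightarrow> (d + d) / 2) (at_right 0)"
    by (rule Lim_transform_eventually) (auto simp: eventually_at_filter field_simps)
  then show "((\<lambda>t. (f' t - f' (- t)) / (2 * t)) \<longlongrightarrow> d) (at_right 0)" by simp
qed

lemma C2_test_second_difference:
  fixes x0 \<eta> :: "real^'n"
  assumes "C2_test_at TYPE('n) \<phi> x0 H"
  shows "((\<lambda>t. (\<phi> (x0 + t *\<^sub>R \<eta>) + \<phi> (x0 - t *\<^sub>R \<eta>) - 2 * \<phi> x0) / t\<^sup>2) \<longlongrightarrow> \<eta> \<bullet> (H *v \<eta>)) (at_right 0)"
proof -
  obtain U g h where U: "open U" "x0 \<in> U"
    and g: "\<And>x. x \<in> U \<Longrightarrow> (\<phi> has_derivative (\<lambda>k. g x \<bullet> k)) (at x)"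
    and h: "\<And>x. x \<in> U \<Longrightarrow> (g has_derivative (\<lambda>k. h x *v k)) (at x)" and H: "h x0 = H"
    using assms unfolding C2_test_at_def by blast
  have path: "((\<lambda>t. x0 + t *\<^sub>R \<eta>) has_derivative (\<lambda>s. s *\<^sub>R \<eta>)) (at t)" for t
    by (auto intro!: derivative_eq_intros)
  have "open ((\<lambda>t. x0 + t *\<^sub>R \<eta>) -` U)"
    by (intro open_vimage U continuous_intros)
  then have "\<forall>\<^sub>F t in nhds 0. t \<in> (\<lambda>t. x0 + t *\<^sub>R \<eta>) -` U"
    using U(2) by (intro eventually_nhds_in_open) simp_all
  then have "\<forall>\<^sub>F t in nhds 0. ((\<lambda>t. \<phi> (x0 + t *\<^sub>R \<eta>)) has_real_derivative g (x0 + t *\<^sub>R \<eta>) \<bullet> \<eta>) (at t)"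
  proof eventually_elim
    case (elim t)
    show ?case
      using has_derivative_compose[OF path g, of t] elim
      by (simp add: has_field_derivative_def mult_commute_abs inner_scaleR_right)
  qed
  moreover have "((\<lambda>t. g (x0 + t *\<^sub>R \<eta>) \<bullet> \<eta>) has_real_derivative \<eta> \<bullet> (H *v \<eta>)) (at 0)"
  proof -
    have "(g has_derivative (\<lambda>k. H *v k)) (at (x0 + 0 *\<^sub>R \<eta>))" using h[OF U(2)] H by simp
    from has_derivative_inner_left[OF has_derivative_compose[OF path this], of \<eta>]
    show ?thesis
      by (simp add: has_field_derivative_def mult_commute_abs matrix_vector_mult_scaleR inner_commute)
  qed
  ultimately show ?thesis
    using second_difference_limit[of "\<lambda>t. \<phi> (x0 + t *\<^sub>R \<eta>)"] by simp
qed

text \<open>Adding the touching inequalities at the two points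
  \<open>x0 + t *\<^sub>R \<eta>\<close> and \<open>x0 - t *\<^sub>R \<eta>\<close> compares second
  differences. First-order terms cancel, so no derivative of \<open>u\<close> appears.\<close>

lemma touching_hessian_le:
  fixes x0 \<eta> :: "real^'n"
  assumes \<phi>: "((\<lambda>t. (\<phi> (x0 + t *\<^sub>R \<eta>) + \<phi> (x0 - t *\<^sub>R \<eta>) - 2 * \<phi> x0) / t\<^sup>2) \<longlongrightarrow> b) (at_right 0)"
    and u: "((\<lambda>t. (u (x0 + t *\<^sub>R \<eta>) + u (x0 - t *\<^sub>R \<eta>) - 2 * u x0) / t\<^sup>2) \<longlongrightarrow> a) (at_right 0)"
    and \<Omega>: "open \<Omega>" "x0 \<in> \<Omega>" and e: "e > 0" "\<forall>x\<in>\<Omega> \<inter> ball x0 e. u x - \<phi> x \<le> u x0 - \<phi> x0"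
  shows "a \<le> b"
proof (rule tendsto_le[OF _ \<phi> u])
  have o: "open (\<Omega> \<inter> ball x0 e)" "x0 \<in> \<Omega> \<inter> ball x0 e" using \<Omega> e by auto
  have "((\<lambda>t. x0 + t *\<^sub>R \<eta>) \<longlongrightarrow> x0) (at_right 0)" "((\<lambda>t. x0 - t *\<^sub>R \<eta>) \<longlongrightarrow> x0) (at_right 0)"
    by (auto intro!: tendsto_eq_intros)
  then have "\<forall>\<^sub>F t in at_right 0. x0 + t *\<^sub>R \<eta> \<in> \<Omega> \<inter> ball x0 e"
    "\<forall>\<^sub>F t in at_right 0. x0 - t *\<^sub>R \<eta> \<in> \<Omega> \<inter> ball x0 e"
    using topological_tendstoD[OF _ o] by blast+
  then show "\<forall>\<^sub>F t in at_right 0. (u (x0 + t *\<^sub>R \<eta>) + u (x0 - t *\<^sub>R \<eta>) - 2 * u x0) / t\<^sup>2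
      \<le> (\<phi> (x0 + t *\<^sub>R \<eta>) + \<phi> (x0 - t *\<^sub>R \<eta>) - 2 * \<phi> x0) / t\<^sup>2"
  proof eventually_elim
    case (elim t)
    then show ?case
      using bspec[OF e(2) elim(1)] bspec[OF e(2) elim(2)] by (intro divide_right_mono) simp_all
  qed
qed simp

text \<open>Here \<open>M x\<close> only has to represent the limits of symmetric second
  differences. This treats smooth points and the origin, where oddness makes these limits vanish, in
  one way.\<close>

lemma viscosity_solutionI:
  fixes u :: "real^'n \<Rightarrow> real"
  assumes "open \<Omega>" "continuous_on \<Omega> u"
    and u: "\<And>x \<eta>. x \<in> \<Omega> \<Longrightarrow> ((\<lambda>t. (u (x + t *\<^sub>R \<eta>) + u (x - t *\<^sub>R \<eta>) - 2 * u x) / t\<^sup>2) \<longlongrightarrow> \<eta> \<bullet> (M x *v \<eta>)) (at_right 0)"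
    and above: "\<And>x H. x \<in> \<Omega> \<Longrightarrow> (\<And>\<eta>. \<eta> \<bullet> (M x *v \<eta>) \<le> \<eta> \<bullet> (H *v \<eta>)) \<Longrightarrow> 0 \<le> F H"
    and below: "\<And>x H. x \<in> \<Omega> \<Longrightarrow> (\<And>\<eta>. \<eta> \<bullet> (H *v \<eta>) \<le> \<eta> \<bullet> (M x *v \<eta>)) \<Longrightarrow> F H \<le> 0"
  shows "viscosity_solution F u \<Omega>"
  unfolding viscosity_solution_def
proof (intro conjI ballI allI impI)
  fix x \<phi> H assume x: "x \<in> \<Omega>" and \<phi>: "C2_test_at TYPE('n) \<phi> x H"
  note s = C2_test_second_difference[OF \<phi>]
  show "F H \<ge> 0" if ex: "\<exists>e>0. \<forall>y\<in>\<Omega> \<inter> ball x e. u y - \<phi> y \<le> u x - \<phi> x"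
  proof (rule above[OF x])
    fix \<eta>
    obtain e where "e > 0" "\<forall>y\<in>\<Omega> \<inter> ball x e. u y - \<phi> y \<le> u x - \<phi> x"
      using ex by blast
    then show "\<eta> \<bullet> (M x *v \<eta>) \<le> \<eta> \<bullet> (H *v \<eta>)"
      by (rule touching_hessian_le[OF s u[OF x] assms(1) x])
  qed
  show "F H \<le> 0" if ex: "\<exists>e>0. \<forall>y\<in>\<Omega> \<inter> ball x e. u y - \<phi> y \<ge> u x - \<phi> x"
  proof (rule below[OF x])
    fix \<eta>
    obtain e where e: "e > 0" "\<forall>y\<in>\<Omega> \<inter> ball x e. u y - \<phi> y \<ge> u x - \<phi> x"
      using ex by blast
    \<comment> \<open>Touching from below is touching from above with \<open>u\<close> and
      \<open>\<phi>\<close> exchanged.\<close>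
    have "\<phi> y - u y \<le> \<phi> x - u x" if "y \<in> \<Omega> \<inter> ball x e" for y
      using bspec[OF e(2) that] by linarith
    with e(1) show "\<eta> \<bullet> (H *v \<eta>) \<le> \<eta> \<bullet> (M x *v \<eta>)"
      by (intro touching_hessian_le[OF u[OF x] s assms(1) x, of e] ballI)
  qed
qed fact

section \<open>Linear algebra of subspaces and isometries\<close>

text \<open>A basis of the orthogonal complement turns membership in \<open>W\<close> into
  \<open>k\<close> linear equations, which can be counted together with other linear
  conditions.\<close>

lemma orthogonal_equations:
  fixes W :: "'a::euclidean_space set"
  assumes "subspace W" "dim W + k = DIM('a)"
  obtains N where "finite N" "card N = k" "\<And>x. (\<And>n. n \<in> N \<Longrightarrow> x \<bullet> n = 0) \<Longrightarrow> x \<in> W"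
proof -
  have "dim {y \<in> UNIV. \<forall>x\<in>W. orthogonal x y} + dim W = dim (UNIV :: 'a set)"
    using assms(1) by (intro dim_subspace_orthogonal_to_vectors) auto
  then have d: "dim (orthogonal_comp W) = k"
    using assms(2) by (simp add: orthogonal_comp_def)
  obtain N where N: "finite N" "N \<subseteq> orthogonal_comp W" "independent N" "orthogonal_comp W \<subseteq> span N" "card N = k"
    using basis_exists[of "orthogonal_comp W"] d finiteI_independent by metis
  show ?thesis
  proof (rule that[OF N(1,5)])
    fix x assume x: "\<And>n. n \<in> N \<Longrightarrow> x \<bullet> n = 0"
    have "orthogonal x y" if "y \<in> orthogonal_comp W" for y
      using N(4) that x by (intro orthogonal_to_span[of y N]) (auto simp: orthogonal_def)
    then have "x \<in> orthogonal_comp (orthogonal_comp W)"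
      by (simp add: orthogonal_comp_def orthogonal_commute)
    then show "x \<in> W" using orthogonal_comp_self[OF assms(1)] by simp
  qed
qed

lemma norm_preserving_inner:
  fixes \<Phi> :: "'a::real_inner \<Rightarrow> 'b::real_inner"
  assumes "linear \<Phi>" "\<And>y. norm (\<Phi> y) = norm y"
  shows "\<Phi> x \<bullet> \<Phi> y = x \<bullet> y"
  using assms(2)[of "x + y"] assms(2)[of x] assms(2)[of y]
  by (simp add: dot_norm linear_add[OF assms(1), symmetric])


section \<open>The cubic form of a symmetric composition algebra\<close>

text \<open>Invariant bilinear form and multiplicative norm, without a unit. The dimension enters
  only later, through \<open>DIM('v) = 8\<close>.\<close>

locale symmetric_composition = bounded_bilinear star
  for star :: "'v::euclidean_space \<Rightarrow> 'v \<Rightarrow> 'v" (infixl "\<star>" 70) +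
  assumes cyclic: "(a \<star> b) \<bullet> c = (b \<star> c) \<bullet> a"
    and composition: "(a \<star> b) \<bullet> (a \<star> b) = (a \<bullet> a) * (b \<bullet> b)"
begin

section \<open>Identities of the product, with their polarizations\<close>

lemmas star_simps = add_left add_right diff_left diff_right minus_left minus_right
  scaleR_left scaleR_right zero_left zero_right

lemma composition_left: "(a \<star> b) \<bullet> (a \<star> c) = (a \<bullet> a) * (b \<bullet> c)"
  using composition[of a "b + c"] composition[of a b] composition[of a c]
  by (simp add: star_simps inner_simps inner_commute algebra_simps)

lemma composition_right: "(b \<star> a) \<bullet> (c \<star> a) = (a \<bullet> a) * (b \<bullet> c)"
  using composition[of "b + c" a] composition[of b a] composition[of c a]
  by (simp add: star_simps inner_simps inner_commute algebra_simps)

text \<open>Tested against an arbitrary \<open>c\<close>: cyclicity moves a factor across the inner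
  product and leaves \<open>composition_left\<close>. Thus right multiplication by \<open>a\<close>
  inverts left multiplication by \<open>a\<close> up to the factor
  \<open>a \<bullet> a\<close>.\<close>

lemma flexible_left: "(a \<star> b) \<star> a = (a \<bullet> a) *\<^sub>R b"
proof (rule vector_eq_rdot[THEN iffD1], rule allI)
  fix c
  show "((a \<star> b) \<star> a) \<bullet> c = ((a \<bullet> a) *\<^sub>R b) \<bullet> c"
    using cyclic[of "a \<star> b" a c] composition_left[of a c b]
    by (simp add: inner_commute)
qed

lemma flexible_right: "a \<star> (b \<star> a) = (a \<bullet> a) *\<^sub>R b"
proof (rule vector_eq_rdot[THEN iffD1], rule allI)
  fix c
  show "(a \<star> (b \<star> a)) \<bullet> c = ((a \<bullet> a) *\<^sub>R b) \<bullet> c"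
    using cyclic[of c a "b \<star> a"] composition_right[of c a b]
    by (simp add: inner_commute)
qed

lemma swap_left: "(a \<star> b) \<star> c = (2 * (a \<bullet> c)) *\<^sub>R b - (c \<star> b) \<star> a"
  using flexible_left[of "a + c" b] flexible_left[of a b] flexible_left[of c b]
  by (simp add: star_simps inner_simps inner_commute algebra_simps)

lemma swap_right: "a \<star> (b \<star> c) = (2 * (a \<bullet> c)) *\<^sub>R b - c \<star> (b \<star> a)"
  using flexible_right[of "a + c" b] flexible_right[of a b] flexible_right[of c b]
  by (simp add: star_simps inner_simps inner_commute algebra_simps)

text \<open>Exchanging the outer factors \<open>c \<star> a\<close> and \<open>b\<close> produces
  \<open>a \<star> (c \<star> a)\<close>, which flexibility collapses.\<close>

lemma moufang: "(c \<star> a) \<star> (a \<star> b) = (2 * ((a \<star> b) \<bullet> c)) *\<^sub>R a - (a \<bullet> a) *\<^sub>R (b \<star> c)"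
  using swap_right[of "c \<star> a" a b] flexible_right[of a c] cyclic[of c a b]
  by (simp add: star_simps)

lemma moufang_linear:
  "(c \<star> a) \<star> (d \<star> b) + (c \<star> d) \<star> (a \<star> b) =
     (2 * ((a \<star> b) \<bullet> c)) *\<^sub>R d + (2 * ((d \<star> b) \<bullet> c)) *\<^sub>R a - (2 * (a \<bullet> d)) *\<^sub>R (b \<star> c)"
  using moufang[of c "a + d" b] moufang[of c a b] moufang[of c d b]
  by (simp add: star_simps inner_simps inner_commute algebra_simps)

lemma norm_star: "norm (a \<star> b) = norm a * norm b"
  by (simp add: norm_eq_sqrt_inner composition real_sqrt_mult)

section \<open>The cubic form, its derivatives and a positivity criterion\<close>

definition cubic :: "'v \<times> 'v \<times> 'v \<Rightarrow> real" where
  "cubic = (\<lambda>(x1, x2, x3). (x1 \<star> x2) \<bullet> x3)"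

definition grad :: "'v \<times> 'v \<times> 'v \<Rightarrow> 'v \<times> 'v \<times> 'v" where
  "grad = (\<lambda>(x1, x2, x3). (x2 \<star> x3, x3 \<star> x1, x1 \<star> x2))"

definition hess :: "'v \<times> 'v \<times> 'v \<Rightarrow> 'v \<times> 'v \<times> 'v \<Rightarrow> 'v \<times> 'v \<times> 'v" where
  "hess = (\<lambda>(z1, z2, z3) (h1, h2, h3).
     (h2 \<star> z3 + z2 \<star> h3, h3 \<star> z1 + z3 \<star> h1, h1 \<star> z2 + z1 \<star> h2))"

text \<open>A Schur complement computation: the determinant of the form is a multiple of the characteristic polynomial.\<close>

lemma column_nonneg:
  assumes l: "l > 0" and D: "l\<^sup>2 - z1 \<bullet> z1 > 0"
    and det: "l ^ 3 - l * (z1 \<bullet> z1 + z2 \<bullet> z2 + z3 \<bullet> z3) + 2 * ((z1 \<star> z2) \<bullet> z3) \<ge> 0"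
  shows "l * (r\<^sup>2 + a \<bullet> a + b \<bullet> b) + 2 * r * (z3 \<bullet> a + z2 \<bullet> b) + 2 * ((z1 \<star> b) \<bullet> a) \<ge> 0"
    (is "?Q \<ge> 0")
proof -
  define D where "D = l\<^sup>2 - z1 \<bullet> z1"
  \<comment> \<open>Completing the square in \<open>a\<close>, with pivot \<open>l\<close>, gives
    \<open>u\<close>; completing it in \<open>b\<close> afterwards, with pivot \<open>D\<close>,
    gives \<open>v\<close>. What remains is a multiple of \<open>r\<^sup>2\<close>.\<close>
  define u where "u = l *\<^sub>R a + r *\<^sub>R z3 + z1 \<star> b"
  define v where "v = D *\<^sub>R b + r *\<^sub>R (l *\<^sub>R z2 - z3 \<star> z1)"
  have c1: "(z1 \<star> b) \<bullet> z3 = (z3 \<star> z1) \<bullet> b" using cyclic[of z3 z1 b] by simp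
  have c2: "(z3 \<star> z1) \<bullet> z2 = (z1 \<star> z2) \<bullet> z3" using cyclic[of z3 z1 z2] by simp
  have u: "u \<bullet> u = l\<^sup>2 * (a \<bullet> a) + r\<^sup>2 * (z3 \<bullet> z3) + (z1 \<bullet> z1) * (b \<bullet> b) + 2 * l * r * (z3 \<bullet> a)
      + 2 * l * ((z1 \<star> b) \<bullet> a) + 2 * r * ((z3 \<star> z1) \<bullet> b)"
    unfolding u_def using composition[of z1 b] c1
    by (simp add: inner_simps inner_commute algebra_simps power2_eq_square)
  have v: "v \<bullet> v = D\<^sup>2 * (b \<bullet> b) + 2 * D * r * (l * (z2 \<bullet> b) - (z3 \<star> z1) \<bullet> b)
      + r\<^sup>2 * (l\<^sup>2 * (z2 \<bullet> z2) + (z3 \<bullet> z3) * (z1 \<bullet> z1) - 2 * l * ((z1 \<star> z2) \<bullet> z3))"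
    unfolding v_def using composition[of z3 z1] c2
    by (simp add: inner_simps inner_commute algebra_simps power2_eq_square)
  have "D * (l * ?Q - u \<bullet> u) = v \<bullet> v + r\<^sup>2 * l *
      (l ^ 3 - l * (z1 \<bullet> z1 + z2 \<bullet> z2 + z3 \<bullet> z3) + 2 * ((z1 \<star> z2) \<bullet> z3))"
    unfolding u v D_def by algebra
  also have "\<dots> \<ge> 0" using l det by simp
  finally have "l * ?Q - u \<bullet> u \<ge> 0"
    using D zero_le_mult_iff[of D "l * ?Q - u \<bullet> u"] unfolding D_def by linarith
  then have "l * ?Q \<ge> 0" using inner_ge_zero[of u] by linarith
  then show ?thesis using l by (simp add: zero_le_mult_iff)
qed

section \<open>The characteristic polynomial and its largest root\<close>

text \<open>For real components this is the determinant of the symmetric 3 by 3 matrix with diagonal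
  \<open>l\<close> and off-diagonal entries \<open>z1\<close>, \<open>z2\<close>,
  \<open>z3\<close>.\<close>

definition charpoly :: "'v \<times> 'v \<times> 'v \<Rightarrow> real \<Rightarrow> real" where
  "charpoly z l = l ^ 3 - l * (z \<bullet> z) + 2 * cubic z"

lemma charpoly_rotate: "charpoly (z2, z3, z1) = charpoly (z1, z2, z3)"
  using cyclic[of z1 z2 z3] by (auto simp: charpoly_def cubic_def fun_eq_iff)

text \<open>The left-hand side is the sum of the forms of \<open>column_nonneg\<close> at the three columns
  (- |x1|^2, x1 * x2, x3 * x1), ... of the adjoint of x.\<close>

lemma gradient_bound_aux:
  fixes x z :: "'v \<times> 'v \<times> 'v"
  assumes z: "z = (z1, z2, z3)" and "norm z1 < l" "norm z2 < l" "norm z3 < l"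
    and p: "charpoly z l \<ge> 0"
  shows "l * (x \<bullet> x)\<^sup>2 + 4 * cubic x * (z \<bullet> x) - 2 * (x \<bullet> x) * (z \<bullet> grad x) \<ge> 0"
proof -
  have l: "l > 0" using assms(2) norm_ge_zero[of z1] by linarith
  \<comment> \<open>The contribution of one column: \<open>moufang\<close> evaluates its mixed term
    through \<open>cubic x\<close> and one component of the gradient.\<close>
  have *: "(x1 \<bullet> x1) * (l * (x1 \<bullet> x1 + x2 \<bullet> x2 + x3 \<bullet> x3)
      - 2 * (z1 \<bullet> (x2 \<star> x3) + z2 \<bullet> (x3 \<star> x1) + z3 \<bullet> (x1 \<star> x2)))
      + 4 * ((x1 \<star> x2) \<bullet> x3) * (z1 \<bullet> x1) \<ge> 0"
    if "norm z1 < l" "charpoly (z1, z2, z3) l \<ge> 0" for x1 x2 x3 z1 z2 z3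
  proof -
    have "(norm z1)\<^sup>2 < l\<^sup>2" using that(1) by (intro power_strict_mono) auto
    then have D: "l\<^sup>2 - z1 \<bullet> z1 > 0" by (simp add: power2_norm_eq_inner)
    have "((z1 \<star> (x3 \<star> x1)) \<bullet> (x1 \<star> x2)) = z1 \<bullet> ((x3 \<star> x1) \<star> (x1 \<star> x2))"
      using cyclic[of z1 "x3 \<star> x1" "x1 \<star> x2"] by (simp add: inner_commute)
    also have "\<dots> = 2 * ((x1 \<star> x2) \<bullet> x3) * (z1 \<bullet> x1) - (x1 \<bullet> x1) * (z1 \<bullet> (x2 \<star> x3))"
      by (simp add: moufang inner_simps)
    finally show ?thesis
      using column_nonneg[OF l D, of z2 z3 "- (x1 \<bullet> x1)" "x1 \<star> x2" "x3 \<star> x1"] that(2)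
      by (simp add: charpoly_def cubic_def composition) (simp add: algebra_simps power2_eq_square)
  qed
  obtain x1 x2 x3 where x: "x = (x1, x2, x3)" by (cases x) auto
  have c: "(x2 \<star> x3) \<bullet> x1 = (x1 \<star> x2) \<bullet> x3" "(x3 \<star> x1) \<bullet> x2 = (x1 \<star> x2) \<bullet> x3"
    using cyclic[of x1 x2 x3] cyclic[of x3 x1 x2] by simp_all
  \<comment> \<open>The other two columns arise by rotating \<open>z\<close> and \<open>x\<close>
    simultaneously.\<close>
  have p2: "charpoly (z2, z3, z1) l \<ge> 0" and p3: "charpoly (z3, z1, z2) l \<ge> 0"
    using p z charpoly_rotate[of z1 z2 z3] charpoly_rotate[of z2 z3 z1] by simp_all
  show ?thesis
    using *[OF assms(2), of z2 z3 x1 x2 x3] *[OF assms(3) p2, of x2 x3 x1]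
      *[OF assms(4) p3, of x3 x1 x2] p
    unfolding x z cubic_def grad_def c by (simp add: c algebra_simps power2_eq_square)
qed

lemma abs_cubic_le: "\<bar>cubic (z1, z2, z3)\<bar> \<le> norm z1 * norm z2 * norm z3"
  using Cauchy_Schwarz_ineq2[of "z1 \<star> z2" z3] by (simp add: cubic_def norm_star)

text \<open>At \<open>norm z1\<close> the cube cancels, leaving \<open>2 * cubic\<close> minus
  \<open>norm z1\<close> times the other two squared norms, and the inequality of arithmetic and
  geometric means applies. Hence the largest root dominates the norm of each component.\<close>

lemma charpoly_component_nonpos: "charpoly (z1, z2, z3) (norm z1) \<le> 0"
proof -
  have "2 * (norm z1 * norm z2 * norm z3) \<le> norm z1 * ((norm z2)\<^sup>2 + (norm z3)\<^sup>2)"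
    using mult_left_mono[OF sum_squares_bound[of "norm z2" "norm z3"], of "norm z1"]
    by (simp add: algebra_simps)
  moreover have "charpoly (z1, z2, z3) (norm z1) =
      2 * cubic (z1, z2, z3) - norm z1 * ((norm z2)\<^sup>2 + (norm z3)\<^sup>2)"
  proof -
    have "(norm z1) ^ 3 = norm z1 * (z1 \<bullet> z1)"
      by (simp add: power3_eq_cube dot_square_norm power2_eq_square)
    then show ?thesis by (simp add: charpoly_def power2_norm_eq_inner algebra_simps)
  qed
  ultimately show ?thesis using abs_cubic_le[of z1 z2 z3] by linarith
qed

text \<open>The supremum of the nonnegative \<open>m\<close> with
  \<open>charpoly z m \<le> 0\<close>; the component norms are such \<open>m\<close>, and growth of
  the cube bounds them. The root is recorded by two one-sided conditions: the first serves the trial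
  vectors, the second the gradient bound.\<close>

lemma largest_root_exists:
  obtains l where "charpoly (z1, z2, z3) l \<le> 0" "\<And>m. m > l \<Longrightarrow> charpoly (z1, z2, z3) m > 0"
    "norm z1 \<le> l" "norm z2 \<le> l" "norm z3 \<le> l"
proof -
  define z where "z = (z1, z2, z3)"
  define S where "S = {m. m \<ge> 0 \<and> charpoly z m \<le> 0}"
  have n: "norm z1 \<in> S" "norm z2 \<in> S" "norm z3 \<in> S"
    using charpoly_component_nonpos[of z1 z2 z3] charpoly_component_nonpos[of z2 z3 z1]
      charpoly_component_nonpos[of z3 z1 z2] charpoly_rotate[of z1 z2 z3] charpoly_rotate[of z2 z3 z1]
    by (simp_all add: S_def z_def)
  have cl: "closed S"
    unfolding S_def charpoly_def by (intro closed_Collect_conj closed_Collect_le continuous_intros)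
  have "m \<le> 1 + z \<bullet> z + 2 * \<bar>cubic z\<bar>" if "m \<in> S" for m
  proof (rule ccontr)
    assume "\<not> ?thesis"
    then have a: "m > 1 + z \<bullet> z + 2 * \<bar>cubic z\<bar>" by simp
    then have m1: "m \<ge> 1" using inner_ge_zero[of z] by linarith
    have "m\<^sup>2 \<ge> m" using m1 by (simp add: power2_eq_square)
    then have "m\<^sup>2 - z \<bullet> z > 2 * \<bar>cubic z\<bar>" using a by linarith
    then have "m * (m\<^sup>2 - z \<bullet> z) > 2 * \<bar>cubic z\<bar>"
      using mult_right_mono[OF m1, of "m\<^sup>2 - z \<bullet> z"] by fastforce
    then have "charpoly z m > 0"
      by (simp add: charpoly_def power2_eq_square power3_eq_cube algebra_simps)
    then show False using that by (simp add: S_def)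
  qed
  then have bdd: "bdd_above S" by (rule bdd_aboveI)
  have "Sup S \<in> S" using closed_contains_Sup[OF _ bdd cl] n by blast
  moreover have "charpoly z m > 0" if "m > Sup S" for m
  proof (rule ccontr)
    assume "\<not> ?thesis"
    moreover have "m \<ge> 0" using that \<open>Sup S \<in> S\<close> by (simp add: S_def)
    ultimately have "m \<in> S" by (simp add: S_def)
    then show False using cSup_upper[OF _ bdd] that by fastforce
  qed
  ultimately show ?thesis
    using that[of "Sup S"] cSup_upper[OF _ bdd] n by (auto simp: S_def z_def)
qed

text \<open>\<open>gradient_bound_aux\<close> asks for values strictly above the component norms, so
  it is applied at every \<open>m > l\<close> and \<open>m\<close> then tends to
  \<open>l\<close>.\<close>

lemma gradient_bound:
  fixes x :: "'v \<times> 'v \<times> 'v"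
  assumes root: "\<And>m. m > l \<Longrightarrow> charpoly (z1, z2, z3) m > 0"
    and n: "norm z1 \<le> l" "norm z2 \<le> l" "norm z3 \<le> l"
  shows "2 * (x \<bullet> x) * ((z1, z2, z3) \<bullet> grad x) - 4 * cubic x * ((z1, z2, z3) \<bullet> x) \<le> l * (x \<bullet> x)\<^sup>2"
    (is "?c \<le> _")
proof (rule tendsto_lowerbound)
  show "((\<lambda>m. m * (x \<bullet> x)\<^sup>2) \<longlongrightarrow> l * (x \<bullet> x)\<^sup>2) (at_right l)"
    by (intro tendsto_intros)
  show "\<forall>\<^sub>F m in at_right l. ?c \<le> m * (x \<bullet> x)\<^sup>2"
    unfolding eventually_at_filter
  proof (intro always_eventually allI impI)
    fix m assume "m \<in> {l<..}"
    then have "m > l" by simp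
    then show "?c \<le> m * (x \<bullet> x)\<^sup>2"
      using gradient_bound_aux[OF refl _ _ _ less_imp_le[OF root], of m x] n by linarith
  qed
qed simp

text \<open>With first component \<open>D *\<^sub>R h\<close>, the other two components of
  \<open>e\<close> solve the last two rows of the eigenvalue equation for \<open>l\<close>. The
  first row then fails exactly by \<open>charpoly\<close> times \<open>h\<close>, because the two
  orthogonality conditions remove the other terms of \<open>moufang_linear\<close>. At a root,
  \<open>e\<close> is an eigenvector.\<close>

lemma eigenvector:
  assumes "h \<bullet> z1 = 0" "h \<bullet> (z2 \<star> z3) = 0"
    and D: "D = l\<^sup>2 - z1 \<bullet> z1"
    and e: "e = (D *\<^sub>R h, l *\<^sub>R (z3 \<star> h) + (h \<star> z2) \<star> z1, l *\<^sub>R (h \<star> z2) + z1 \<star> (z3 \<star> h))"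
  shows "hess (z1, z2, z3) e = l *\<^sub>R e - (charpoly (z1, z2, z3) l *\<^sub>R h, 0, 0)"
proof -
  have c: "(h \<star> z2) \<bullet> z3 = 0" "z2 \<bullet> (z3 \<star> h) = 0"
    using assms(2) cyclic[of h z2 z3] cyclic[of z3 h z2] by (simp_all add: inner_commute)
  have 1: "((h \<star> z2) \<star> z1) \<star> z3 = - ((z3 \<star> z1) \<star> (h \<star> z2))"
    using swap_left[of "h \<star> z2" z1 z3] c by simp
  have 2: "z2 \<star> (z1 \<star> (z3 \<star> h)) = - ((z3 \<star> h) \<star> (z1 \<star> z2))"
    using swap_right[of z2 z1 "z3 \<star> h"] c by simp
  have "((h \<star> z2) \<star> z1) \<star> z3 + z2 \<star> (z1 \<star> (z3 \<star> h)) = - (2 * ((z1 \<star> z2) \<bullet> z3)) *\<^sub>R h"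
    using moufang_linear[of z3 z1 h z2] c assms(1) unfolding 1 2
    by (simp add: inner_commute algebra_simps)
  then have S: "((h \<star> z2) \<star> z1) \<star> z3 = - (2 * ((z1 \<star> z2) \<bullet> z3)) *\<^sub>R h - z2 \<star> (z1 \<star> (z3 \<star> h))"
    by (simp add: algebra_simps)
  have f: "(z3 \<star> h) \<star> z3 = (z3 \<bullet> z3) *\<^sub>R h" "z2 \<star> (h \<star> z2) = (z2 \<bullet> z2) *\<^sub>R h"
    "(z1 \<star> (z3 \<star> h)) \<star> z1 = (z1 \<bullet> z1) *\<^sub>R (z3 \<star> h)"
    "z1 \<star> ((h \<star> z2) \<star> z1) = (z1 \<bullet> z1) *\<^sub>R (h \<star> z2)"
    by (simp_all add: flexible_left flexible_right)
  show ?thesis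
    unfolding e hess_def
    by (simp add: star_simps f S charpoly_def cubic_def D)
       (simp add: algebra_simps power2_eq_square power3_eq_cube)
qed

section \<open>Taylor expansion and homogeneity\<close>

text \<open>The exact Taylor expansion, which certifies \<open>grad\<close> and \<open>hess\<close>
  as the derivatives of the form.\<close>

lemma cubic_line:
  "cubic (x + t *\<^sub>R h) = cubic x + t * (grad x \<bullet> h) + t\<^sup>2 / 2 * (hess x h \<bullet> h) + t ^ 3 * cubic h"
proof -
  obtain x1 x2 x3 where x: "x = (x1, x2, x3)" by (cases x) auto
  obtain h1 h2 h3 where h: "h = (h1, h2, h3)" by (cases h) auto
  have c: "(x2 \<star> x3) \<bullet> h1 = (h1 \<star> x2) \<bullet> x3" "(x3 \<star> h1) \<bullet> h2 = (h1 \<star> h2) \<bullet> x3"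
    "(x3 \<star> x1) \<bullet> h2 = (x1 \<star> h2) \<bullet> x3" "(h3 \<star> x1) \<bullet> h2 = (x1 \<star> h2) \<bullet> h3"
    "(x2 \<star> h3) \<bullet> h1 = (h1 \<star> x2) \<bullet> h3" "(h2 \<star> x3) \<bullet> h1 = (h1 \<star> h2) \<bullet> x3"
    using cyclic[of h1 x2 x3] cyclic[of x3 h1 h2] cyclic[of x3 x1 h2] cyclic[of h3 x1 h2]
      cyclic[of h1 x2 h3] cyclic[of h1 h2 x3] by simp_all
  show ?thesis
    unfolding x h cubic_def grad_def hess_def
    by (simp add: star_simps inner_simps c)
       (simp add: algebra_simps power2_eq_square power3_eq_cube add_divide_distrib)
qed

lemma hess_add_left: "hess (x + y) h = hess x h + hess y h"
  by (cases x; cases y; cases h) (simp add: hess_def star_simps algebra_simps)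

lemma hess_scaleR_left: "hess (c *\<^sub>R x) h = c *\<^sub>R hess x h"
  by (cases x; cases h) (simp add: hess_def star_simps algebra_simps)

lemma hess_diff_left: "hess (x - y) h = hess x h - hess y h"
  using hess_add_left[of "x - y" y h] by (simp add: algebra_simps)

lemma hess_commute: "hess x h = hess h x"
  by (cases x; cases h) (simp add: hess_def algebra_simps)

lemma linear_hess: "linear (hess x)"
  by (rule linearI)
    (simp_all add: hess_commute[of x] hess_add_left hess_scaleR_left)

lemma grad_inner_self: "grad x \<bullet> x = 3 * cubic x"
proof -
  obtain x1 x2 x3 where x: "x = (x1, x2, x3)" by (cases x) auto
  show ?thesis
    using cyclic[of x1 x2 x3] cyclic[of x3 x1 x2] by (simp add: x grad_def cubic_def)
qed

lemma grad_line:
  "grad (x + t *\<^sub>R h) = grad x + t *\<^sub>R hess x h + t\<^sup>2 *\<^sub>R grad h"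
  by (cases x; cases h) (simp add: grad_def hess_def star_simps algebra_simps power2_eq_square)

lemma cubic_scaleR: "cubic (c *\<^sub>R x) = c ^ 3 * cubic x"
  by (cases x) (simp add: cubic_def star_simps power3_eq_cube)

lemma abs_cubic_le_norm: "\<bar>cubic z\<bar> \<le> norm z ^ 3"
proof -
  obtain z1 z2 z3 where z: "z = (z1, z2, z3)" by (cases z) auto
  have "norm z1 \<le> norm z" "norm z2 \<le> norm z" "norm z3 \<le> norm z"
    using norm_fst_le[of z1 "(z2, z3)"] norm_snd_le[of "(z2, z3)" z1] norm_fst_le[of z2 z3] norm_snd_le[of z3 z2]
    unfolding z by linarith+
  then have "norm z1 * norm z2 * norm z3 \<le> norm z * norm z * norm z"
    by (intro mult_mono) auto
  then show ?thesis using abs_cubic_le[of z1 z2 z3] by (simp add: z power3_eq_cube)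
qed

lemma has_derivative_cubic_line:
  "((\<lambda>t. cubic (x + t *\<^sub>R h)) has_real_derivative grad (x + t *\<^sub>R h) \<bullet> h) (at t)"
  unfolding cubic_line
  by (auto intro!: derivative_eq_intros
      simp: grad_line inner_simps grad_inner_self power2_eq_square algebra_simps)

section \<open>The quotient of the cubic form by the squared norm\<close>

text \<open>Division by zero gives 0 at the origin, in agreement with homogeneity of degree
  one.\<close>

definition ratio :: "'v \<times> 'v \<times> 'v \<Rightarrow> real" where
  "ratio x = cubic x / (x \<bullet> x)"

lemma ratio_scaleR: "ratio (c *\<^sub>R x) = c * ratio x"
  by (cases "c = 0") (simp_all add: ratio_def cubic_scaleR power3_eq_cube)

text \<open>Integrate \<open>gradient_bound\<close> along the segment from Y to X; a segment through the origin is treated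
  separately, by homogeneity.\<close>

lemma ratio_diff_le:
  assumes z: "X - Y = (z1, z2, z3)"
    and root: "\<And>m. m > l \<Longrightarrow> charpoly (z1, z2, z3) m > 0"
    and n: "norm z1 \<le> l" "norm z2 \<le> l" "norm z3 \<le> l"
  shows "2 * (ratio X - ratio Y) \<le> l"
proof (cases "\<exists>t\<in>{0..1}. Y + t *\<^sub>R (X - Y) = 0")
  case True
  then obtain t where t: "Y + t *\<^sub>R (X - Y) = 0" by blast
  then have Y: "Y = (- t) *\<^sub>R (X - Y)" by (simp add: eq_neg_iff_add_eq_0)
  then have X: "X = (1 - t) *\<^sub>R (X - Y)" by (simp add: algebra_simps)
  \<comment> \<open>Both points are multiples of \<open>X - Y\<close>, with coefficients differing
    by one.\<close>
  have "ratio X - ratio Y = ratio (X - Y)"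
    using arg_cong[OF X, of ratio] arg_cong[OF Y, of ratio] unfolding ratio_scaleR
    by (simp add: algebra_simps)
  moreover have "2 * ratio (X - Y) \<le> l"
  proof (cases "X - Y = 0")
    case True
    then show ?thesis using order_trans[OF norm_ge_zero n(1)] by (simp add: ratio_def)
  next
    case False
    define s where "s = (X - Y) \<bullet> (X - Y)"
    have s: "s > 0" using False by (simp add: s_def)
    \<comment> \<open>The gradient bound at the point \<open>X - Y\<close> itself; Euler's identity
      \<open>grad_inner_self\<close> makes the coefficient 6 - 4 = 2.\<close>
    have "2 * cubic (X - Y) * s \<le> l * s * s"
      using gradient_bound[OF root n, of "X - Y"] grad_inner_self[of "X - Y"]
      unfolding z[symmetric] s_def[symmetric]
      by (simp add: inner_commute s_def[symmetric] power2_eq_square algebra_simps)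
    then show ?thesis using s by (simp add: ratio_def s_def[symmetric] field_simps)
  qed
  ultimately show ?thesis by simp
next
  case False
  define z where "z = X - Y"
  define f where "f t = ratio (Y + t *\<^sub>R z)" for t
  define f' where "f' t = (grad (Y + t *\<^sub>R z) \<bullet> z * ((Y + t *\<^sub>R z) \<bullet> (Y + t *\<^sub>R z))
     - cubic (Y + t *\<^sub>R z) * (2 * (z \<bullet> (Y + t *\<^sub>R z)))) / ((Y + t *\<^sub>R z) \<bullet> (Y + t *\<^sub>R z))\<^sup>2" for t
  have "(f has_real_derivative f' t) (at t)" if "0 \<le> t" "t \<le> 1" for t
  proof -
    have nz: "Y + t *\<^sub>R z \<noteq> 0" using False that by (auto simp: z_def)
    have "((\<lambda>t. (Y + t *\<^sub>R z) \<bullet> (Y + t *\<^sub>R z)) has_real_derivative 2 * (z \<bullet> (Y + t *\<^sub>R z))) (at t)"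
      unfolding inner_add_left inner_add_right inner_scaleR_left inner_scaleR_right
      by (auto intro!: derivative_eq_intros simp: inner_commute algebra_simps)
    from DERIV_divide[OF has_derivative_cubic_line this] nz
    show ?thesis unfolding f_def[abs_def] f'_def ratio_def by (simp add: power2_eq_square)
  qed
  then obtain t where t: "0 < t" "t < 1" "f 1 - f 0 = (1 - 0) * f' t"
    using MVT2[of 0 1 f f'] by auto
  define x where "x = Y + t *\<^sub>R z"
  have x: "x \<bullet> x > 0" using False t by (auto simp: x_def z_def)
  have "2 * (x \<bullet> x) * (z \<bullet> grad x) - 4 * cubic x * (z \<bullet> x) \<le> l * (x \<bullet> x)\<^sup>2"
    using gradient_bound[OF root n, of x] unfolding z_def z .
  then have "2 * f' t \<le> l"
    using x unfolding f'_def x_def[symmetric] by (simp add: field_simps inner_commute)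
  then show ?thesis using t(3) by (simp add: f_def z_def)
qed

section \<open>Trial vectors for the Hessian\<close>

text \<open>For \<open>norm z1 < l\<close> the vectors of \<open>eigenvector\<close> serve, with its
  two orthogonality conditions as \<open>C\<close>; since \<open>charpoly\<close> is nonpositive at
  \<open>l\<close>, the defect only raises the form. For \<open>norm z1 = l\<close> that
  construction degenerates, as \<open>D\<close> becomes 0.\<close>

lemma trial_space:
  assumes p: "charpoly (z1, z2, z3) l \<le> 0" and n: "norm z1 \<le> l"
  obtains e :: "'v \<Rightarrow> 'v \<times> 'v \<times> 'v" and C where "linear e" "\<And>h. e h = 0 \<Longrightarrow> h = 0" "finite C" "card C \<le> 2"
    "\<And>h. (\<And>c. c \<in> C \<Longrightarrow> h \<bullet> c = 0) \<Longrightarrow> l * (e h \<bullet> e h) \<le> hess (z1, z2, z3) (e h) \<bullet> e h"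
proof (cases "norm z1 = l")
  case True
  \<comment> \<open>These vectors give the form value \<open>l\<close> already through the block of
    \<open>z1\<close>, which couples the last two components. For \<open>z1 = 0\<close> the inverse
    is 0, and so are \<open>l\<close> and the form.\<close>
  define e where "e h = (0 :: 'v, h, inverse (norm z1) *\<^sub>R (z1 \<star> h))" for h
  have "linear e"
    by (rule linearI) (simp_all add: e_def star_simps algebra_simps)
  moreover have "l * (e h \<bullet> e h) \<le> hess (z1, z2, z3) (e h) \<bullet> e h" for h
  proof (cases "z1 = 0")
    case True
    with \<open>norm z1 = l\<close> show ?thesis by (simp add: e_def hess_def star_simps)
  next
    case False
    show ?thesis
    proof -
      have "z1 \<bullet> z1 = l * l" "l \<noteq> 0"
        using False \<open>norm z1 = l\<close> by (auto simp: dot_square_norm power2_eq_square)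
      then show ?thesis using \<open>norm z1 = l\<close>
        by (simp add: e_def hess_def star_simps flexible_left composition) (simp add: field_simps)
    qed
  qed
  ultimately show ?thesis using that[of e "{}"] by (auto simp: e_def zero_prod_def)
next
  case False
  define D where "D = l\<^sup>2 - z1 \<bullet> z1"
  have "(norm z1)\<^sup>2 < l\<^sup>2" using False n by (intro power_strict_mono) auto
  then have D: "D > 0" by (simp add: D_def power2_norm_eq_inner)
  define e where "e h = (D *\<^sub>R h, l *\<^sub>R (z3 \<star> h) + (h \<star> z2) \<star> z1, l *\<^sub>R (h \<star> z2) + z1 \<star> (z3 \<star> h))" for h
  have "linear e"
    by (rule linearI) (simp_all add: e_def star_simps algebra_simps)
  moreover have "h = 0" if "e h = 0" for h
    using that D by (simp add: e_def zero_prod_def)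
  moreover have "l * (e h \<bullet> e h) \<le> hess (z1, z2, z3) (e h) \<bullet> e h"
    if "\<And>c. c \<in> {z1, z2 \<star> z3} \<Longrightarrow> h \<bullet> c = 0" for h
  proof -
    have "(charpoly (z1, z2, z3) l *\<^sub>R h, 0::'v, 0::'v) \<bullet> e h = charpoly (z1, z2, z3) l * (D * (h \<bullet> h))"
      by (simp add: e_def)
    also have "\<dots> \<le> 0" using p D by (simp add: mult_nonpos_nonneg)
    finally show ?thesis
      using eigenvector[OF _ _ D_def e_def, of h] that by (simp add: inner_diff_left)
  qed
  moreover have "card {z1, z2 \<star> z3} \<le> 2" by (simp add: card_insert_if)
  ultimately show ?thesis using that[of e "{z1, z2 \<star> z3}"] by blast
qed

text \<open>A dimension count: two conditions from \<open>trial_space\<close> and at most five from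
  \<open>N\<close> leave a nonzero \<open>h\<close> in dimension eight.\<close>

lemma trial_vector:
  fixes N :: "('v \<times> 'v \<times> 'v) set"
  assumes "charpoly (z1, z2, z3) l \<le> 0" "norm z1 \<le> l"
    and dim: "DIM('v) = 8" and N: "finite N" "card N \<le> 5"
  obtains \<xi> where "norm \<xi> = 1" "\<And>n. n \<in> N \<Longrightarrow> \<xi> \<bullet> n = 0" "l \<le> hess (z1, z2, z3) \<xi> \<bullet> \<xi>"
proof -
  obtain e :: "'v \<Rightarrow> 'v \<times> 'v \<times> 'v" and C where e: "linear e" "\<And>h. e h = 0 \<Longrightarrow> h = 0" and C: "finite C" "card C \<le> 2"
    and le: "\<And>h. (\<And>c. c \<in> C \<Longrightarrow> h \<bullet> c = 0) \<Longrightarrow> l * (e h \<bullet> e h) \<le> hess (z1, z2, z3) (e h) \<bullet> e h"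
    using trial_space[OF assms(1,2)] by metis
  \<comment> \<open>The adjoint pulls the conditions on \<open>e h\<close> back to conditions on
    \<open>h\<close>.\<close>
  define S where "S = C \<union> adjoint e ` N"
  have "card S \<le> 2 + 5"
    unfolding S_def using C N card_image_le[OF N(1), of "adjoint e"]
    by (intro order_trans[OF card_Un_le] add_mono) auto
  moreover have "dim S \<le> card S" using C N by (intro dim_le_card') (simp add: S_def)
  ultimately have "dim S < DIM('v)" using dim by simp
  then obtain h where h: "h \<noteq> 0" "\<And>y. y \<in> span S \<Longrightarrow> orthogonal h y"
    using orthogonal_to_subspace_exists[of S] by metis
  then have hS: "h \<bullet> y = 0" if "y \<in> S" for y
    using span_base[OF that] by (simp add: orthogonal_def)
  have eh: "e h \<noteq> 0" using e(2) h(1) by blast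
  define \<xi> where "\<xi> = inverse (norm (e h)) *\<^sub>R e h"
  have "l * (e h \<bullet> e h) \<le> hess (z1, z2, z3) (e h) \<bullet> e h"
    by (rule le) (simp add: hS S_def)
  then have "l \<le> hess (z1, z2, z3) \<xi> \<bullet> \<xi>"
    using eh unfolding \<xi>_def linear_scale[OF linear_hess]
    by (simp add: dot_square_norm field_simps power2_eq_square)
  moreover have "\<xi> \<bullet> n = 0" if "n \<in> N" for n
    using hS[of "adjoint e n"] that adjoint_works[OF e(1), of h n] by (simp add: S_def \<xi>_def)
  ultimately show ?thesis using that[of \<xi>] eh by (simp add: \<xi>_def)
qed

text \<open>The largest root for \<open>X - Y\<close> plays three parts: through the component norms
  it controls the distance, it bounds the difference of ratios, and the form exceeds it on a trial
  vector.\<close>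

lemma indefinite_direction:
  fixes X Y :: "'v \<times> 'v \<times> 'v"
  assumes "DIM('v) = 8" "finite N" "card N \<le> 5"
  obtains l \<xi> where "0 \<le> l" "(norm (X - Y))\<^sup>2 \<le> 3 * l\<^sup>2" "2 * (ratio X - ratio Y) \<le> l"
    "norm \<xi> = 1" "\<And>n. n \<in> N \<Longrightarrow> \<xi> \<bullet> n = 0" "l \<le> hess (X - Y) \<xi> \<bullet> \<xi>"
proof -
  obtain z1 z2 z3 where z: "X - Y = (z1, z2, z3)" by (cases "X - Y") auto
  obtain l where l: "charpoly (z1, z2, z3) l \<le> 0" "\<And>m. m > l \<Longrightarrow> charpoly (z1, z2, z3) m > 0"
    "norm z1 \<le> l" "norm z2 \<le> l" "norm z3 \<le> l"
    using largest_root_exists[of z1 z2 z3] by metis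
  obtain \<xi> where "norm \<xi> = 1" "\<And>n. n \<in> N \<Longrightarrow> \<xi> \<bullet> n = 0" "l \<le> hess (z1, z2, z3) \<xi> \<bullet> \<xi>"
    using trial_vector[OF l(1,3) assms] by metis
  moreover have "(norm (X - Y))\<^sup>2 \<le> 3 * l\<^sup>2"
    using power_mono[OF l(3), of 2] power_mono[OF l(4), of 2] power_mono[OF l(5), of 2]
    by (simp add: z power2_norm_eq_inner)
  ultimately show ?thesis
    using that[of l \<xi>] ratio_diff_le[OF z l(2-5)] order_trans[OF norm_ge_zero l(3)] z by simp
qed

subsection \<open>The form divided by a power of the norm\<close>

definition weighted :: "real \<Rightarrow> 'v \<times> 'v \<times> 'v \<Rightarrow> real" where
  "weighted \<delta> x = cubic x / norm x powr \<delta>"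

text \<open>The Hessian of \<open>weighted \<delta>\<close> at x multiplied by |x|^\<delta>. It vanishes at 0 because division by zero yields zero.\<close>

definition whess :: "real \<Rightarrow> 'v \<times> 'v \<times> 'v \<Rightarrow> 'v \<times> 'v \<times> 'v \<Rightarrow> 'v \<times> 'v \<times> 'v" where
  "whess \<delta> x \<xi> = hess x \<xi> - (\<delta> * ratio x) *\<^sub>R \<xi>
     - (\<delta> / (x \<bullet> x)) *\<^sub>R ((x \<bullet> \<xi>) *\<^sub>R grad x + (grad x \<bullet> \<xi>) *\<^sub>R x)
     + (\<delta> * (\<delta> + 2) * cubic x / (x \<bullet> x)\<^sup>2 * (x \<bullet> \<xi>)) *\<^sub>R x"

lemma linear_whess: "linear (whess \<delta> x)"
  unfolding whess_def using linear_hess[of x]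
  by (intro linearI) (simp_all add: linear_add linear_scale inner_simps algebra_simps add_divide_distrib)

lemma grad_scaleR: "grad (c *\<^sub>R x) = c\<^sup>2 *\<^sub>R grad x"
  by (cases x) (simp add: grad_def star_simps power2_eq_square)

text \<open>The scalar may be negative. This oddness later turns arbitrary linear combinations of
  two Hessians into differences.\<close>

lemma whess_scaleR: "whess \<delta> (c *\<^sub>R x) \<xi> = c *\<^sub>R whess \<delta> x \<xi>"
proof (cases "c = 0 \<or> x = 0")
  case True
  then have "c *\<^sub>R x = 0" by auto
  moreover have "whess \<delta> 0 \<xi> = 0"
    using hess_scaleR_left[of 0 0 \<xi>] by (simp add: whess_def ratio_def)
  ultimately show ?thesis using True by auto
next
  case False
  have "\<delta> / (c\<^sup>2 * (x \<bullet> x)) * c ^ 3 = c * (\<delta> / (x \<bullet> x))"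
    using False by (simp add: field_simps power2_eq_square power3_eq_cube)
  moreover have "\<delta> * (\<delta> + 2) * (c ^ 3 * cubic x) / (c\<^sup>2 * (x \<bullet> x))\<^sup>2 * (c * (x \<bullet> \<xi>)) * c
      = c * (\<delta> * (\<delta> + 2) * cubic x / (x \<bullet> x)\<^sup>2 * (x \<bullet> \<xi>))"
    using False by (simp add: field_simps power2_eq_square power3_eq_cube)
  ultimately show ?thesis
    unfolding whess_def
    by (simp add: hess_scaleR_left ratio_scaleR grad_scaleR cubic_scaleR scaleR_add_right scaleR_diff_right
        power2_eq_square power3_eq_cube mult_ac)
qed

lemma norm_powr_eq: "norm (v :: 'v \<times> 'v \<times> 'v) powr \<delta> = (v \<bullet> v) powr (\<delta> / 2)"
proof (cases "v = 0")
  case False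
  then have "norm v = (v \<bullet> v) powr (1 / 2)"
    by (simp add: norm_eq_sqrt_inner powr_half_sqrt)
  then show ?thesis by (simp add: powr_powr)
qed simp

text \<open>Away from the origin, the function on a line is a polynomial times a power of the
  positive quadratic \<open>q\<close>, differentiated twice. At the origin oddness makes the second
  difference vanish, and the right side is 0 because \<open>0 powr r = 0\<close>.\<close>

lemma weighted_second_difference:
  "((\<lambda>t. (weighted \<delta> (x + t *\<^sub>R h) + weighted \<delta> (x - t *\<^sub>R h) - 2 * weighted \<delta> x) / t\<^sup>2)
     \<longlongrightarrow> norm x powr (- \<delta>) * (whess \<delta> x h \<bullet> h)) (at_right 0)"
proof (cases "x = 0")
  case True
  have odd: "weighted \<delta> (- v) = - weighted \<delta> v" for v
    using cubic_scaleR[of "- 1" v] by (simp add: weighted_def)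
  have "weighted \<delta> 0 = 0" by (simp add: weighted_def)
  then show ?thesis using True odd by simp
next
  case False
  define q where "q t = (x + t *\<^sub>R h) \<bullet> (x + t *\<^sub>R h)" for t
  define p where "p t = cubic (x + t *\<^sub>R h)" for t
  define q' where "q' t = 2 * (x \<bullet> h) + 2 * t * (h \<bullet> h)" for t
  define p' where "p' t = grad (x + t *\<^sub>R h) \<bullet> h" for t
  define f where "f t = p t * q t powr (- \<delta> / 2)" for t
  define f' where "f' t = p' t * q t powr (- \<delta> / 2) + p t * (- \<delta> / 2 * q t powr (- \<delta> / 2 - 1) * q' t)" for t
  have f: "weighted \<delta> (x + t *\<^sub>R h) = f t" for t
    by (simp add: f_def p_def q_def weighted_def norm_powr_eq powr_minus_divide)
  have dq: "(q has_real_derivative q' t) (at t)" for t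
    unfolding q_def[abs_def] q'_def inner_add_left inner_add_right inner_scaleR_left inner_scaleR_right
    by (auto intro!: derivative_eq_intros simp: inner_commute algebra_simps)
  have dp: "(p has_real_derivative p' t) (at t)" for t
    unfolding p_def[abs_def] p'_def by (rule has_derivative_cubic_line)
  have dq': "(q' has_real_derivative 2 * (h \<bullet> h)) (at t)" for t
    unfolding q'_def[abs_def] by (auto intro!: derivative_eq_intros)
  have dp': "(p' has_real_derivative hess x h \<bullet> h) (at 0)"
    unfolding p'_def[abs_def] grad_line inner_add_left inner_scaleR_left
    by (auto intro!: derivative_eq_intros)
  have q0: "q 0 > 0" using False by (simp add: q_def)
  have dpow: "((\<lambda>t. q t powr r) has_real_derivative r * q t powr (r - 1) * q' t) (at t)" if "q t > 0" for t r
    using that by (auto intro!: derivative_eq_intros dq simp: powr_diff field_simps)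
  have "isCont q 0" using dq[of 0] by (rule DERIV_isCont)
  then have "\<forall>\<^sub>F t in at 0. q t > 0" using q0 by (simp add: isCont_def order_tendsto_iff)
  then have "\<forall>\<^sub>F t in nhds 0. q t > 0" using q0 by (simp add: eventually_nhds_conv_at)
  then have 1: "\<forall>\<^sub>F t in nhds 0. (f has_real_derivative f' t) (at t)"
  proof eventually_elim
    case (elim t)
    show ?case
      using DERIV_mult[OF dp[of t] dpow[OF elim, of "- \<delta> / 2"]]
      unfolding f_def[abs_def] f'_def by (simp add: mult.commute)
  qed
  have 2: "(f' has_real_derivative norm x powr (- \<delta>) * (whess \<delta> x h \<bullet> h)) (at 0)"
  proof -
    define s where "s = x \<bullet> x"
    have s: "s > 0" using False by (simp add: s_def)
    have e: "q 0 = s" "p 0 = cubic x" "q' 0 = 2 * (x \<bullet> h)" "p' 0 = grad x \<bullet> h"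
      by (simp_all add: q_def p_def q'_def p'_def s_def)
    have w: "norm x powr (- \<delta>) = s powr (- \<delta> / 2)"
      "s powr (- \<delta> / 2 - 1) = s powr (- \<delta> / 2) / s"
      "s powr (- \<delta> / 2 - 1 - 1) = s powr (- \<delta> / 2) / s\<^sup>2"
      using s powr_diff[of s "- \<delta> / 2" 1] powr_diff[of s "- \<delta> / 2 - 1" 1]
        norm_powr_eq[of x "- \<delta>"]
      by (simp_all only: s_def[symmetric] powr_one power2_eq_square less_imp_le divide_divide_eq_left)
    have W: "whess \<delta> x h \<bullet> h = hess x h \<bullet> h - \<delta> * cubic x / s * (h \<bullet> h)
        - 2 * \<delta> / s * (x \<bullet> h) * (grad x \<bullet> h) + \<delta> * (\<delta> + 2) * cubic x / s\<^sup>2 * (x \<bullet> h)\<^sup>2"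
      unfolding whess_def ratio_def s_def[symmetric]
      by (simp add: inner_simps power2_eq_square algebra_simps)
    have "(f' has_real_derivative
        (hess x h \<bullet> h) * q 0 powr (- \<delta> / 2) + (- \<delta> / 2 * q 0 powr (- \<delta> / 2 - 1) * q' 0) * p' 0
        + (p' 0 * (- \<delta> / 2 * q 0 powr (- \<delta> / 2 - 1) * q' 0)
         + ((- \<delta> / 2 * ((- \<delta> / 2 - 1) * q 0 powr (- \<delta> / 2 - 1 - 1) * q' 0)) * q' 0
            + 2 * (h \<bullet> h) * (- \<delta> / 2 * q 0 powr (- \<delta> / 2 - 1))) * p 0)) (at 0)"
      unfolding f'_def[abs_def]
      by (intro DERIV_add DERIV_mult DERIV_cmult dp dp' dq' dpow q0)
    also have "(hess x h \<bullet> h) * q 0 powr (- \<delta> / 2) + (- \<delta> / 2 * q 0 powr (- \<delta> / 2 - 1) * q' 0) * p' 0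
        + (p' 0 * (- \<delta> / 2 * q 0 powr (- \<delta> / 2 - 1) * q' 0)
         + ((- \<delta> / 2 * ((- \<delta> / 2 - 1) * q 0 powr (- \<delta> / 2 - 1 - 1) * q' 0)) * q' 0
            + 2 * (h \<bullet> h) * (- \<delta> / 2 * q 0 powr (- \<delta> / 2 - 1))) * p 0)
        = norm x powr (- \<delta>) * (whess \<delta> x h \<bullet> h)"
      unfolding e w W using s by (simp add: field_simps power2_eq_square)
    finally show ?thesis .
  qed
  show ?thesis
    using second_difference_limit[OF 1 2] f f[of 0] f[of "- t" for t] by simp
qed

text \<open>At the origin, \<open>abs_cubic_le_norm\<close> bounds the function by
  \<open>norm v powr (3 - \<delta>)\<close>, whose exponent is at least one.\<close>

lemma continuous_weighted:
  assumes "\<delta> \<le> 2"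
  shows "continuous_on UNIV (weighted \<delta>)"
proof (rule continuous_at_imp_continuous_on, rule ballI)
  fix x
  have c: "isCont cubic x"
    unfolding cubic_def case_prod_unfold by (intro continuous_intros isCont)
  show "isCont (weighted \<delta>) x"
  proof (cases "x = 0")
    case False
    then show ?thesis unfolding weighted_def[abs_def] by (intro continuous_intros c) auto
  next
    case True
    have "\<forall>\<^sub>F v in at 0. norm (weighted \<delta> v) \<le> norm (v :: 'v \<times> 'v \<times> 'v)"
      unfolding eventually_at
    proof (intro exI[of _ 1] conjI ballI impI)
      fix v :: "'v \<times> 'v \<times> 'v" assume "v \<noteq> 0 \<and> dist v 0 < 1"
      then have v: "norm v > 0" "norm v \<le> 1" by auto
      have "norm (weighted \<delta> v) \<le> norm v ^ 3 / norm v powr \<delta>"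
        using abs_cubic_le_norm[of v] by (simp add: weighted_def divide_right_mono)
      also have "\<dots> = norm v powr (3 - \<delta>)"
        using v by (simp add: powr_diff)
      also have "\<dots> \<le> norm v powr 1" using v assms by (intro powr_mono') auto
      finally show "norm (weighted \<delta> v) \<le> norm v" using v by simp
    qed simp
    then have "weighted \<delta> \<midarrow>0\<rightarrow> 0"
      by (rule Lim_null_comparison) (auto intro!: tendsto_eq_intros)
    then show ?thesis using True by (simp add: isCont_def weighted_def)
  qed
qed

section \<open>Restriction to a subspace: trace and indefiniteness\<close>

text \<open>The matrix of the form of \<open>whess\<close> pulled back along \<open>\<Phi>\<close>,
  in the coordinates of the subspace.\<close>

definition restricted_hess :: "real \<Rightarrow> (real^'n \<Rightarrow> 'v \<times> 'v \<times> 'v) \<Rightarrow> real^'n \<Rightarrow> real^'n^'n" where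
  "restricted_hess \<delta> \<Phi> y = matrix (\<lambda>\<eta>. adjoint \<Phi> (whess \<delta> (\<Phi> y) (\<Phi> \<eta>)))"

lemma restricted_hess_form:
  fixes \<Phi> :: "real^'n \<Rightarrow> 'v \<times> 'v \<times> 'v"
  assumes "linear \<Phi>"
  shows "\<eta> \<bullet> (restricted_hess \<delta> \<Phi> y *v \<zeta>) = \<Phi> \<eta> \<bullet> whess \<delta> (\<Phi> y) (\<Phi> \<zeta>)"
proof -
  have "linear (\<lambda>\<eta>. adjoint \<Phi> (whess \<delta> (\<Phi> y) (\<Phi> \<eta>)))"
    using linear_compose[OF linear_compose[OF assms linear_whess] adjoint_linear[OF assms]]
    by (simp add: o_def)
  then show ?thesis
    by (simp add: restricted_hess_def matrix_works adjoint_works[OF assms])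
qed

definition hess_trace :: "(real^'n \<Rightarrow> 'v \<times> 'v \<times> 'v) \<Rightarrow> 'v \<times> 'v \<times> 'v \<Rightarrow> real" where
  "hess_trace \<Phi> z = (\<Sum>i\<in>UNIV. \<Phi> (axis i 1) \<bullet> hess z (\<Phi> (axis i 1)))"

lemma linear_hess_trace: "linear (hess_trace \<Phi>)"
  by (rule linearI)
    (simp_all add: hess_trace_def hess_add_left hess_scaleR_left inner_add_right sum.distrib sum_distrib_left)

text \<open>The three correction terms of \<open>whess\<close> contribute
  \<open>- CARD('n) * \<delta>\<close>, \<open>- 6 * \<delta>\<close> and
  \<open>\<delta> * (\<delta> + 2)\<close> times the ratio; the 6 is twice the 3 of Euler's
  identity.\<close>

lemma trace_restricted_hess:
  fixes \<delta> :: real and \<Phi> :: "real^'n \<Rightarrow> 'v \<times> 'v \<times> 'v"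
  assumes lin: "linear \<Phi>" and nrm: "\<And>y. norm (\<Phi> y) = norm y"
  shows "trace (restricted_hess \<delta> \<Phi> y) = hess_trace \<Phi> (\<Phi> y) - \<delta> * (CARD('n) + 4 - \<delta>) * ratio (\<Phi> y)"
proof -
  define e where "e i = \<Phi> (axis i 1)" for i :: 'n
  define x where "x = \<Phi> y"
  have "restricted_hess \<delta> \<Phi> y $ i $ i = e i \<bullet> whess \<delta> x (e i)" for i
    using restricted_hess_form[OF lin, of "axis i 1" \<delta> y "axis i 1"]
    by (simp add: inner_axis' matrix_vector_mult_basis column_def e_def x_def)
  moreover have ee: "e i \<bullet> e i = 1" for i
    by (simp add: e_def norm_preserving_inner[OF lin nrm] inner_axis_axis)
  define a b where "a = 2 * \<delta> / (x \<bullet> x)" and "b = \<delta> * (\<delta> + 2) * cubic x / (x \<bullet> x)\<^sup>2"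
  have "e i \<bullet> whess \<delta> x (e i) = e i \<bullet> hess x (e i) - \<delta> * ratio x
      - a * ((x \<bullet> e i) * (grad x \<bullet> e i)) + b * ((x \<bullet> e i) * (x \<bullet> e i))" for i
    unfolding whess_def a_def b_def by (simp add: inner_simps ee inner_commute algebra_simps)
  \<comment> \<open>Parseval: \<open>x\<close> lies in the range of \<open>\<Phi>\<close>, so the
    partial orthonormal system recovers the full inner product even for \<open>v\<close> outside
    that range.\<close>
  moreover have contract: "(\<Sum>i\<in>UNIV. (x \<bullet> e i) * (v \<bullet> e i)) = v \<bullet> x" for v
  proof -
    have "x \<bullet> e i = y $ i" "v \<bullet> e i = adjoint \<Phi> v $ i" for i
      using adjoint_works[OF lin, of "axis i 1" v]
      by (simp_all add: x_def e_def norm_preserving_inner[OF lin nrm] inner_axis inner_axis' inner_commute)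
    then show ?thesis
      using adjoint_works[OF lin, of y v] by (simp add: inner_vec_def x_def inner_commute)
  qed
  ultimately have "trace (restricted_hess \<delta> \<Phi> y) = hess_trace \<Phi> x - CARD('n) * (\<delta> * ratio x)
      - a * (3 * cubic x) + b * (x \<bullet> x)"
    by (simp add: trace_def hess_trace_def e_def[symmetric] sum.distrib sum_subtractf
        sum_distrib_left[symmetric] grad_inner_self contract)
  moreover have "a * (3 * cubic x) = 6 * \<delta> * ratio x" by (simp add: a_def ratio_def)
  moreover have "b * (x \<bullet> x) = \<delta> * (\<delta> + 2) * ratio x"
    by (simp add: b_def ratio_def power2_eq_square)
  ultimately show ?thesis by (simp add: x_def[symmetric] algebra_simps)
qed

lemma restricted_hess_scaleR:
  fixes \<Phi> :: "real^'n \<Rightarrow> 'v \<times> 'v \<times> 'v"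
  assumes lin: "linear \<Phi>"
  shows "restricted_hess \<delta> \<Phi> (c *\<^sub>R y) = c *\<^sub>R restricted_hess \<delta> \<Phi> y"
  unfolding restricted_hess_def
  by (simp add: linear_scale[OF lin] whess_scaleR linear_scale[OF adjoint_linear[OF lin]] matrix_def vec_eq_iff)

text \<open>Five conditions are imposed on the direction: three place it in the subspace, two make
  it orthogonal to \<open>X\<close> and \<open>Y\<close>. The form value \<open>h\<close> there is
  at least \<open>(1 - \<delta> / 2) * l\<close>, and both terms of the trace difference are bounded
  by multiples of \<open>h\<close>.\<close>

lemma uniform_indefiniteness:
  fixes \<Phi> :: "real^'n \<Rightarrow> 'v \<times> 'v \<times> 'v"
  assumes \<delta>: "1 \<le> \<delta>" "\<delta> < 2" and lin: "linear \<Phi>" and nrm: "\<And>y. norm (\<Phi> y) = norm y"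
    and dim: "DIM('v) = 8" and card: "CARD('n) = 21"
  obtains c where "c > 0" "\<And>y y'. \<exists>\<eta>. norm \<eta> = 1 \<and>
     \<bar>trace (restricted_hess \<delta> \<Phi> y - restricted_hess \<delta> \<Phi> y')\<bar>
       \<le> c * (\<eta> \<bullet> ((restricted_hess \<delta> \<Phi> y - restricted_hess \<delta> \<Phi> y') *v \<eta>))"
proof -
  obtain T where T: "T > 0" "\<And>z. \<bar>hess_trace \<Phi> z\<bar> \<le> T * norm z"
    using linear_bounded_pos[OF linear_hess_trace, of \<Phi>] by (metis real_norm_def)
  \<comment> \<open>The ratio coefficient in \<open>trace_restricted_hess\<close>, with 25 = 21 +
    4.\<close>
  define \<kappa> where "\<kappa> = \<delta> * (25 - \<delta>)"
  have \<kappa>: "\<kappa> > 0" using \<delta> by (simp add: \<kappa>_def)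
  define c where "c = 4 * T / (2 - \<delta>) + \<kappa> * (1 / (2 - \<delta>) + 1)"
  have inj: "inj \<Phi>"
    using lin nrm by (metis linear_injective_0 norm_eq_zero)
  have "dim (range \<Phi>) = 21"
    using dim_image_eq[OF lin, of UNIV] inj card by (simp add: dim_UNIV)
  then have "dim (range \<Phi>) + 3 = DIM('v \<times> 'v \<times> 'v)" using dim by simp
  then obtain N where N: "finite N" "card N = 3" "\<And>x. (\<And>n. n \<in> N \<Longrightarrow> x \<bullet> n = 0) \<Longrightarrow> x \<in> range \<Phi>"
    using orthogonal_equations[OF linear_subspace_image[OF lin subspace_UNIV], of 3] by metis
  have "\<exists>\<eta>. norm \<eta> = 1 \<and> \<bar>trace (restricted_hess \<delta> \<Phi> y - restricted_hess \<delta> \<Phi> y')\<bar>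
       \<le> c * (\<eta> \<bullet> ((restricted_hess \<delta> \<Phi> y - restricted_hess \<delta> \<Phi> y') *v \<eta>))" for y y'
  proof -
    define X Y where "X = \<Phi> y" and "Y = \<Phi> y'"
    have fin: "finite (N \<union> {X, Y})" using N(1) by simp
    have "card (N \<union> {X, Y}) \<le> 3 + 2"
      using N(2) by (intro order_trans[OF card_Un_le] add_mono) (auto simp: card_insert_if)
    then have "card (N \<union> {X, Y}) \<le> 5" by simp
    then obtain l \<xi> where l: "0 \<le> l" "(norm (X - Y))\<^sup>2 \<le> 3 * l\<^sup>2" "2 * (ratio X - ratio Y) \<le> l"
      and \<xi>: "norm \<xi> = 1" "\<And>n. n \<in> N \<union> {X, Y} \<Longrightarrow> \<xi> \<bullet> n = 0" "l \<le> hess (X - Y) \<xi> \<bullet> \<xi>"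
      using indefinite_direction[OF dim fin, of X Y] by metis
    obtain \<eta> where \<eta>: "\<xi> = \<Phi> \<eta>" using N(3)[of \<xi>] \<xi>(2) by blast
    define m where "m = ratio X - ratio Y"
    define h where "h = \<eta> \<bullet> ((restricted_hess \<delta> \<Phi> y - restricted_hess \<delta> \<Phi> y') *v \<eta>)"
    \<comment> \<open>Orthogonality kills the rank-two and rank-one terms of \<open>whess\<close>,
      leaving \<open>hess\<close> minus a multiple of the identity.\<close>
    have o: "X \<bullet> \<xi> = 0" "Y \<bullet> \<xi> = 0" using \<xi>(2)[of X] \<xi>(2)[of Y] by (simp_all add: inner_commute)
    have "h = \<xi> \<bullet> whess \<delta> X \<xi> - \<xi> \<bullet> whess \<delta> Y \<xi>"
      by (simp add: h_def matrix_vector_mult_diff_rdistrib inner_diff_right restricted_hess_form[OF lin] \<eta> X_def Y_def)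
    also have "\<dots> = hess (X - Y) \<xi> \<bullet> \<xi> - \<delta> * m"
      using \<xi>(1) o by (simp add: whess_def m_def hess_diff_left inner_simps inner_commute dot_square_norm algebra_simps)
    finally have h: "h \<ge> l - \<delta> * m" using \<xi>(3) by simp
    have "2 * m \<le> l" using l(3) by (simp add: m_def)
    then have "\<delta> * (2 * m) \<le> \<delta> * l" using \<delta> by (intro mult_left_mono) auto
    then have lh': "(2 - \<delta>) * l \<le> 2 * h" using h by (simp add: algebra_simps)
    then have lh: "l \<le> 2 * h / (2 - \<delta>)" using \<delta> by (simp add: field_simps)
    have "0 \<le> (2 - \<delta>) * l" using l(1) \<delta> by simp
    then have h0: "h \<ge> 0" using lh' by linarith
    have mh: "\<bar>m\<bar> \<le> (1 / (2 - \<delta>) + 1) * h"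
    proof (cases "m \<ge> 0")
      case True
      then have "\<bar>m\<bar> \<le> h / (2 - \<delta>)" using \<open>2 * m \<le> l\<close> lh by simp
      then show ?thesis using h0 by (simp add: algebra_simps)
    next
      case False
      \<comment> \<open>A negative \<open>m\<close> increases \<open>h\<close> by
        \<open>\<delta> * \<bar>m\<bar>\<close>, which is at least \<open>\<bar>m\<bar>\<close>
        because \<open>1 \<le> \<delta>\<close>.\<close>
      then have "1 * (- m) \<le> \<delta> * (- m)" using \<delta> by (intro mult_right_mono) auto
      then have "\<bar>m\<bar> \<le> h" using h l(1) False by linarith
      moreover have "0 \<le> h / (2 - \<delta>)" using h0 \<delta> by simp
      ultimately show ?thesis by (simp add: algebra_simps)
    qed
    have "(2 * l)\<^sup>2 = 4 * l\<^sup>2" by (simp add: power_mult_distrib)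
    then have "(norm (X - Y))\<^sup>2 \<le> (2 * l)\<^sup>2" using l(2) zero_le_power2[of l] by linarith
    then have "norm (X - Y) \<le> 2 * l" by (rule power2_le_imp_le) (use l(1) in simp)
    then have n: "norm (X - Y) \<le> 4 * h / (2 - \<delta>)" using lh by simp
    have "trace (restricted_hess \<delta> \<Phi> y - restricted_hess \<delta> \<Phi> y') = hess_trace \<Phi> (X - Y) - \<kappa> * m"
      by (simp add: trace_sub trace_restricted_hess[OF lin nrm] card X_def Y_def \<kappa>_def m_def
          linear_diff[OF linear_hess_trace] algebra_simps)
    then have "\<bar>trace (restricted_hess \<delta> \<Phi> y - restricted_hess \<delta> \<Phi> y')\<bar> \<le> \<bar>hess_trace \<Phi> (X - Y)\<bar> + \<kappa> * \<bar>m\<bar>"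
      using \<kappa> abs_triangle_ineq4[of "hess_trace \<Phi> (X - Y)" "\<kappa> * m"] by (simp add: abs_mult)
    also have "\<dots> \<le> T * (4 * h / (2 - \<delta>)) + \<kappa> * ((1 / (2 - \<delta>) + 1) * h)"
      using T \<kappa> mh n by (intro add_mono mult_left_mono order_trans[OF T(2)]) auto
    also have "\<dots> = c * h" by (simp add: c_def algebra_simps)
    finally have "\<bar>trace (restricted_hess \<delta> \<Phi> y - restricted_hess \<delta> \<Phi> y')\<bar> \<le> c * h" .
    moreover have "norm \<eta> = 1" using \<xi>(1) nrm \<eta> by simp
    ultimately show ?thesis unfolding h_def by blast
  qed
  moreover have "c > 0" using T(1) \<kappa> \<delta> by (simp add: c_def add_pos_pos)
  ultimately show ?thesis using that by blast
qed

theorem weighted_isaacs: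
  fixes \<Phi> :: "real^'n \<Rightarrow> 'v \<times> 'v \<times> 'v"
  assumes \<delta>: "1 \<le> \<delta>" "\<delta> < 2" and lin: "linear \<Phi>" and nrm: "\<And>y. norm (\<Phi> y) = norm y"
    and dim: "DIM('v) = 8" and card: "CARD('n) = 21" and \<Omega>: "open \<Omega>"
  shows "\<exists>C>0. \<exists>(Bs :: (real^'n^'n) set set) (As :: (real^'n^'n) set)
            (Lab :: (real^'n^'n) set \<Rightarrow> real^'n^'n \<Rightarrow> real^'n^'n).
           Bs \<noteq> {} \<and> As \<noteq> {} \<and>
           (\<forall>b\<in>Bs. \<forall>a\<in>As. unif_elliptic C (Lab b a)) \<and>
           viscosity_solution (\<lambda>M. SUP b\<in>Bs. INF a\<in>As. lin_op (Lab b a) M) (\<lambda>y. weighted \<delta> (\<Phi> y)) \<Omega>"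
proof -
  let ?M = "restricted_hess \<delta> \<Phi>"
  obtain c where c: "c > 0" "\<And>y y'. \<exists>\<eta>. norm \<eta> = 1 \<and>
     \<bar>trace (?M y - ?M y')\<bar> \<le> c * (\<eta> \<bullet> ((?M y - ?M y') *v \<eta>))"
    using uniform_indefiniteness[OF \<delta> lin nrm dim card] by metis
  have indef: "\<exists>\<eta>. norm \<eta> = 1 \<and> \<bar>trace (a *\<^sub>R P + b *\<^sub>R Q)\<bar> \<le> c * (\<eta> \<bullet> ((a *\<^sub>R P + b *\<^sub>R Q) *v \<eta>))"
    if PQ: "P \<in> range ?M" "Q \<in> range ?M" for P Q a b
  proof -
    obtain y y' where "P = ?M y" "Q = ?M y'" using PQ by blast
    \<comment> \<open>Homogeneity and oddness absorb both coefficients into the base points.\<close>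
    then have "a *\<^sub>R P + b *\<^sub>R Q = ?M (a *\<^sub>R y) - ?M ((- b) *\<^sub>R y')"
      by (simp only: restricted_hess_scaleR[OF lin]) simp
    then show ?thesis using c(2)[of "a *\<^sub>R y" "(- b) *\<^sub>R y'"] by simp
  qed
  have ne: "range ?M \<noteq> {}" by simp
  obtain C and Bs :: "(real^'n^'n) set set" and As :: "(real^'n^'n) set"
    and Lab :: "(real^'n^'n) set \<Rightarrow> real^'n^'n \<Rightarrow> real^'n^'n"
    where C: "C > 0" "Bs \<noteq> {}" "As \<noteq> {}" "\<forall>b\<in>Bs. \<forall>a\<in>As. unif_elliptic C (Lab b a)"
    and above: "\<forall>M\<in>range ?M. \<forall>H. (\<forall>\<eta>. \<eta> \<bullet> (M *v \<eta>) \<le> \<eta> \<bullet> (H *v \<eta>))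
      \<longrightarrow> 0 \<le> (SUP b\<in>Bs. INF a\<in>As. lin_op (Lab b a) H)"
    and below: "\<forall>M\<in>range ?M. \<forall>H. (\<forall>\<eta>. \<eta> \<bullet> (H *v \<eta>) \<le> \<eta> \<bullet> (M *v \<eta>))
      \<longrightarrow> (SUP b\<in>Bs. INF a\<in>As. lin_op (Lab b a) H) \<le> 0"
    by (rule isaacs_operator_exists[OF c(1) ne indef])
  have "viscosity_solution (\<lambda>M. SUP b\<in>Bs. INF a\<in>As. lin_op (Lab b a) M) (\<lambda>y. weighted \<delta> (\<Phi> y)) \<Omega>"
  \<comment> \<open>The factor \<open>norm y powr (- \<delta>)\<close> of the Hessian moves into the
    argument by homogeneity, so every Hessian lies in \<open>range ?M\<close>; at
    \<open>y = 0\<close> it is the zero matrix.\<close>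
  proof (rule viscosity_solutionI[where M = "\<lambda>y. ?M (norm y powr (- \<delta>) *\<^sub>R y)", OF \<Omega>])
    have "continuous_on UNIV \<Phi>"
      using lin by (simp add: linear_continuous_on linear_conv_bounded_linear)
    then show "continuous_on \<Omega> (\<lambda>y. weighted \<delta> (\<Phi> y))"
      using continuous_on_compose2[OF continuous_weighted[of \<delta>], of UNIV \<Phi>] \<delta>
      by (auto intro: continuous_on_subset[of UNIV])
    show "((\<lambda>t. (weighted \<delta> (\<Phi> (x + t *\<^sub>R \<eta>)) + weighted \<delta> (\<Phi> (x - t *\<^sub>R \<eta>)) - 2 * weighted \<delta> (\<Phi> x)) / t\<^sup>2)
        \<longlongrightarrow> \<eta> \<bullet> (?M (norm x powr (- \<delta>) *\<^sub>R x) *v \<eta>)) (at_right 0)" for x \<eta>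
      using weighted_second_difference[of \<delta> "\<Phi> x" "\<Phi> \<eta>"]
      by (simp add: restricted_hess_form[OF lin] linear_add[OF lin] linear_diff[OF lin] linear_scale[OF lin]
          whess_scaleR nrm inner_commute)
  qed (use above below in blast)+
  with C show ?thesis by blast
qed

end

section \<open>Octonions\<close>

lemma oct_triples_eq: "oct_triples =
   {(7, 1, 3), (1, 3, 7), (3, 7, 1), (1, 2, 4), (2, 4, 1), (4, 1, 2), (2, 3, 5),
    (3, 5, 2), (5, 2, 3), (3, 4, 6), (4, 6, 3), (6, 3, 4), (4, 5, 7), (5, 7, 4),
    (7, 4, 5), (5, 6, 1), (6, 1, 5), (1, 5, 6), (6, 7, 2), (7, 2, 6), (2, 6, 7)}"
proof -
  have "{..<7::nat} = {0, 1, 2, 3, 4, 5, 6}" by auto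
  then show ?thesis by (simp add: oct_triples_def om_def insert_commute numeral_2_eq_2[symmetric])
qed

lemma oct_mul_expand:
  "oct_mul a b 0 = a 0 * b 0 - a 1 * b 1 - a 2 * b 2 - a 3 * b 3 - a 4 * b 4 - a 5 * b 5 - a 6 * b 6 - a 7 * b 7"
  "oct_mul a b 1 = a 0 * b 1 + a 1 * b 0 + a 2 * b 4 + a 3 * b 7 - a 4 * b 2 + a 5 * b 6 - a 6 * b 5 - a 7 * b 3"
  "oct_mul a b 2 = a 0 * b 2 - a 1 * b 4 + a 2 * b 0 + a 3 * b 5 + a 4 * b 1 - a 5 * b 3 + a 6 * b 7 - a 7 * b 6"
  "oct_mul a b 3 = a 0 * b 3 - a 1 * b 7 - a 2 * b 5 + a 3 * b 0 + a 4 * b 6 + a 5 * b 2 - a 6 * b 4 + a 7 * b 1"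
  "oct_mul a b 4 = a 0 * b 4 + a 1 * b 2 - a 2 * b 1 - a 3 * b 6 + a 4 * b 0 + a 5 * b 7 + a 6 * b 3 - a 7 * b 5"
  "oct_mul a b 5 = a 0 * b 5 - a 1 * b 6 + a 2 * b 3 - a 3 * b 2 - a 4 * b 7 + a 5 * b 0 + a 6 * b 1 + a 7 * b 4"
  "oct_mul a b 6 = a 0 * b 6 + a 1 * b 5 - a 2 * b 7 + a 3 * b 4 - a 4 * b 3 - a 5 * b 1 + a 6 * b 0 + a 7 * b 2"
  "oct_mul a b 7 = a 0 * b 7 + a 1 * b 3 + a 2 * b 6 - a 3 * b 1 + a 4 * b 5 - a 5 * b 4 - a 6 * b 2 + a 7 * b 0"
proof -
  have 8: "{..<8::nat} = {0, 1, 2, 3, 4, 5, 6, 7}" by auto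
  show "oct_mul a b 0 = a 0 * b 0 - a 1 * b 1 - a 2 * b 2 - a 3 * b 3 - a 4 * b 4 - a 5 * b 5 - a 6 * b 6 - a 7 * b 7"
    by (simp add: oct_mul_def 8 oct_c_def oct_triples_eq)
  show "oct_mul a b 1 = a 0 * b 1 + a 1 * b 0 + a 2 * b 4 + a 3 * b 7 - a 4 * b 2 + a 5 * b 6 - a 6 * b 5 - a 7 * b 3"
    by (simp add: oct_mul_def 8 oct_c_def oct_triples_eq)
  show "oct_mul a b 2 = a 0 * b 2 - a 1 * b 4 + a 2 * b 0 + a 3 * b 5 + a 4 * b 1 - a 5 * b 3 + a 6 * b 7 - a 7 * b 6"
    by (simp add: oct_mul_def 8 oct_c_def oct_triples_eq)
  show "oct_mul a b 3 = a 0 * b 3 - a 1 * b 7 - a 2 * b 5 + a 3 * b 0 + a 4 * b 6 + a 5 * b 2 - a 6 * b 4 + a 7 * b 1"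
    by (simp add: oct_mul_def 8 oct_c_def oct_triples_eq)
  show "oct_mul a b 4 = a 0 * b 4 + a 1 * b 2 - a 2 * b 1 - a 3 * b 6 + a 4 * b 0 + a 5 * b 7 + a 6 * b 3 - a 7 * b 5"
    by (simp add: oct_mul_def 8 oct_c_def oct_triples_eq)
  show "oct_mul a b 5 = a 0 * b 5 - a 1 * b 6 + a 2 * b 3 - a 3 * b 2 - a 4 * b 7 + a 5 * b 0 + a 6 * b 1 + a 7 * b 4"
    by (simp add: oct_mul_def 8 oct_c_def oct_triples_eq)
  show "oct_mul a b 6 = a 0 * b 6 + a 1 * b 5 - a 2 * b 7 + a 3 * b 4 - a 4 * b 3 - a 5 * b 1 + a 6 * b 0 + a 7 * b 2"
    by (simp add: oct_mul_def 8 oct_c_def oct_triples_eq)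
  show "oct_mul a b 7 = a 0 * b 7 + a 1 * b 3 + a 2 * b 6 - a 3 * b 1 + a 4 * b 5 - a 5 * b 4 - a 6 * b 2 + a 7 * b 0"
    by (simp add: oct_mul_def 8 oct_c_def oct_triples_eq)
qed

section \<open>The conjugated octonion product on 8-tuples\<close>

text \<open>Unlike coefficient functions on \<open>nat\<close>, nested pairs of reals form a
  Euclidean space of dimension eight, as the locale requires.\<close>

type_synonym octonion = "real \<times> real \<times> real \<times> real \<times> real \<times> real \<times> real \<times> real"

definition oct_tuple :: "(nat \<Rightarrow> real) \<Rightarrow> octonion" where
  "oct_tuple f = (f 0, f 1, f 2, f 3, f 4, f 5, f 6, f 7)"

definition oct_coord :: "octonion \<Rightarrow> nat \<Rightarrow> real" where
  "oct_coord = (\<lambda>(a0, a1, a2, a3, a4, a5, a6, a7) k. [a0, a1, a2, a3, a4, a5, a6, a7] ! k)"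

text \<open>The conjugate of the octonion product, which is a symmetric composition, unlike the product itself.\<close>

definition conj_mul :: "octonion \<Rightarrow> octonion \<Rightarrow> octonion" where
  "conj_mul a b = oct_tuple (\<lambda>k. (if k = 0 then 1 else - 1) * oct_mul (oct_coord a) (oct_coord b) k)"

lemma conj_mul_expand: "conj_mul (a0, a1, a2, a3, a4, a5, a6, a7) (b0, b1, b2, b3, b4, b5, b6, b7) =
  (a0 * b0 - a1 * b1 - a2 * b2 - a3 * b3 - a4 * b4 - a5 * b5 - a6 * b6 - a7 * b7,
    - a0 * b1 - a1 * b0 - a2 * b4 - a3 * b7 + a4 * b2 - a5 * b6 + a6 * b5 + a7 * b3,
    - a0 * b2 + a1 * b4 - a2 * b0 - a3 * b5 - a4 * b1 + a5 * b3 - a6 * b7 + a7 * b6,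
    - a0 * b3 + a1 * b7 + a2 * b5 - a3 * b0 - a4 * b6 - a5 * b2 + a6 * b4 - a7 * b1,
    - a0 * b4 - a1 * b2 + a2 * b1 + a3 * b6 - a4 * b0 - a5 * b7 - a6 * b3 + a7 * b5,
    - a0 * b5 + a1 * b6 - a2 * b3 + a3 * b2 + a4 * b7 - a5 * b0 - a6 * b1 - a7 * b4,
    - a0 * b6 - a1 * b5 + a2 * b7 - a3 * b4 + a4 * b3 + a5 * b1 - a6 * b0 - a7 * b2,
    - a0 * b7 - a1 * b3 - a2 * b6 + a3 * b1 - a4 * b5 + a5 * b4 + a6 * b2 - a7 * b0)"
  by (simp add: conj_mul_def oct_tuple_def oct_mul_expand oct_coord_def del: One_nat_def)

lemma conj_mul_oct_tuple:
  "conj_mul (oct_tuple a) (oct_tuple b) = oct_tuple (\<lambda>k. (if k = 0 then 1 else - 1) * oct_mul a b k)"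
  unfolding oct_tuple_def conj_mul_expand oct_mul_expand by simp

text \<open>Degen's eight-square identity; conjugation leaves the norm unchanged.\<close>

lemma conj_mul_composition: "conj_mul a b \<bullet> conj_mul a b = (a \<bullet> a) * (b \<bullet> b)"
proof -
  obtain a0 a1 a2 a3 a4 a5 a6 a7 where a: "a = (a0, a1, a2, a3, a4, a5, a6, a7)" by (cases a) auto
  obtain b0 b1 b2 b3 b4 b5 b6 b7 where b: "b = (b0, b1, b2, b3, b4, b5, b6, b7)" by (cases b) auto
  show ?thesis
    unfolding a b conj_mul_expand inner_Pair inner_real_def by algebra
qed

text \<open>Pairing the conjugate of \<open>a b\<close> with \<open>c\<close> gives the real part of
  \<open>(a b) c\<close>, which is cyclic in the factors; checked as a polynomial identity.\<close>

lemma conj_mul_cyclic: "conj_mul a b \<bullet> c = conj_mul b c \<bullet> a"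
proof -
  obtain a0 a1 a2 a3 a4 a5 a6 a7 where a: "a = (a0, a1, a2, a3, a4, a5, a6, a7)" by (cases a) auto
  obtain b0 b1 b2 b3 b4 b5 b6 b7 where b: "b = (b0, b1, b2, b3, b4, b5, b6, b7)" by (cases b) auto
  obtain c0 c1 c2 c3 c4 c5 c6 c7 where c: "c = (c0, c1, c2, c3, c4, c5, c6, c7)" by (cases c) auto
  show ?thesis
    unfolding a b c conj_mul_expand inner_Pair inner_real_def by algebra
qed

lemma conj_mul_linear:
  "conj_mul (a + a') b = conj_mul a b + conj_mul a' b" "conj_mul (r *\<^sub>R a) b = r *\<^sub>R conj_mul a b"
  "conj_mul a (b + b') = conj_mul a b + conj_mul a b'" "conj_mul a (r *\<^sub>R b) = r *\<^sub>R conj_mul a b"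
proof -
  obtain a0 a1 a2 a3 a4 a5 a6 a7 where a: "a = (a0, a1, a2, a3, a4, a5, a6, a7)" by (cases a) auto
  obtain c0 c1 c2 c3 c4 c5 c6 c7 where c: "a' = (c0, c1, c2, c3, c4, c5, c6, c7)" by (cases a') auto
  obtain b0 b1 b2 b3 b4 b5 b6 b7 where b: "b = (b0, b1, b2, b3, b4, b5, b6, b7)" by (cases b) auto
  obtain d0 d1 d2 d3 d4 d5 d6 d7 where d: "b' = (d0, d1, d2, d3, d4, d5, d6, d7)" by (cases b') auto
  show "conj_mul (a + a') b = conj_mul a b + conj_mul a' b" "conj_mul (r *\<^sub>R a) b = r *\<^sub>R conj_mul a b"
    "conj_mul a (b + b') = conj_mul a b + conj_mul a b'" "conj_mul a (r *\<^sub>R b) = r *\<^sub>R conj_mul a b"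
    unfolding a b c d by (simp_all add: conj_mul_expand algebra_simps)
qed

interpretation octonion: symmetric_composition conj_mul
proof
  show "\<exists>K. \<forall>a b. norm (conj_mul a b) \<le> norm a * norm b * K"
    by (intro exI[of _ 1]) (simp add: norm_eq_sqrt_inner conj_mul_composition real_sqrt_mult)
qed (fact conj_mul_linear conj_mul_cyclic conj_mul_composition)+

section \<open>Identification of the 24 coordinates with three octonions\<close>

text \<open>\<open>oct_block\<close> reads coordinates through \<open>of_nat\<close>; on the numbers
  below 24 this map is onto, hence bijective by cardinality.\<close>

lemma sum_UNIV_24: "(\<Sum>i\<in>UNIV. f (i :: 24)) = (\<Sum>k<24. f (of_nat k))"
proof -
  have surj: "(of_nat :: nat \<Rightarrow> 24) ` {..<24} = UNIV"
  proof (rule UNIV_eq_I[symmetric])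
    fix x :: 24
    obtain z where z: "x = of_int z" "0 \<le> z" "z < int CARD(24)" by (cases x) auto
    then have "x = of_nat (nat z)" by simp
    moreover have "nat z \<in> {..<24}" using z by simp
    ultimately show "x \<in> of_nat ` {..<24}" by (rule image_eqI)
  qed
  then have "inj_on (of_nat :: nat \<Rightarrow> 24) {..<24}"
    by (intro eq_card_imp_inj_on) (simp_all only: finite_lessThan card_lessThan surj, simp)
  then show ?thesis
    using sum.reindex[of "of_nat :: nat \<Rightarrow> 24" "{..<24}" f] unfolding surj by (simp only: o_def)
qed

definition oct_triple :: "real^24 \<Rightarrow> octonion \<times> octonion \<times> octonion" where
  "oct_triple x = (oct_tuple (oct_block x 0), oct_tuple (oct_block x 1), oct_tuple (oct_block x 2))"

lemma linear_oct_triple: "linear oct_triple"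
  by (rule linearI) (simp_all add: oct_triple_def oct_tuple_def oct_block_def)

lemma sum_lessThan_add: "(\<Sum>k<a + b. f k) = (\<Sum>k<a. f k) + (\<Sum>k<b. f (a + k))"
  for f :: "nat \<Rightarrow> 'a::comm_monoid_add"
  by (induction b) (simp_all add: add.assoc)

lemma inner_oct_tuple: "oct_tuple f \<bullet> oct_tuple g = (\<Sum>k<8. f k * g k)"
proof -
  have 8: "{..<8::nat} = {0, 1, 2, 3, 4, 5, 6, 7}" by auto
  show ?thesis unfolding oct_tuple_def 8 by (simp del: One_nat_def)
qed

lemma norm_oct_triple: "norm (oct_triple x) = norm x"
proof -
  let ?s = "\<lambda>k. x $ of_nat k * x $ of_nat k"
  have "x \<bullet> x = (\<Sum>k<8 + (8 + 8). ?s k)"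
    unfolding inner_vec_def inner_real_def sum_UNIV_24 by simp
  also have "\<dots> = (\<Sum>k<8. ?s k) + ((\<Sum>k<8. ?s (8 + k)) + (\<Sum>k<8. ?s (8 + (8 + k))))"
    by (simp only: sum_lessThan_add)
  also have "\<dots> = oct_triple x \<bullet> oct_triple x"
    by (simp add: oct_triple_def inner_oct_tuple oct_block_def add.assoc[symmetric])
  finally show ?thesis by (simp add: norm_eq_sqrt_inner)
qed

text \<open>The signs of conjugation are those with which an inner product differs from the real
  part of a product.\<close>

lemma cubic_oct_triple: "octonion.cubic (oct_triple x) = P24 x"
  unfolding octonion.cubic_def oct_triple_def case_prod_conv conj_mul_oct_tuple P24_def oct_Re_def
    oct_mul_expand(1)[of "oct_mul _ _"]
  by (simp add: oct_tuple_def del: One_nat_def)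

theorem theorem1p2:
  fixes \<delta> :: real and H' :: "(real^24) set" and L :: "real^21 \<Rightarrow> real^24"
  assumes "1 \<le> \<delta>" and "\<delta> < 2"
    and "subspace H'" and "dim H' = 21"
    and "linear L" and "\<And>y. norm (L y) = norm y" and "range L = H'"
  shows "\<exists>C>0. \<exists>(Bs :: (real^21^21) set set) (As :: (real^21^21) set)
            (Lab :: (real^21^21) set \<Rightarrow> real^21^21 \<Rightarrow> real^21^21).
           Bs \<noteq> {} \<and> As \<noteq> {} \<and>
           (\<forall>b\<in>Bs. \<forall>a\<in>As. unif_elliptic C (Lab b a)) \<and>
           viscosity_solution (\<lambda>M. SUP b\<in>Bs. INF a\<in>As. lin_op (Lab b a) M)
             (\<lambda>y. P24 (L y) / norm (L y) powr \<delta>) (ball 0 1)"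
proof -
  \<comment> \<open>Followed by the isometry \<open>oct_triple\<close>, \<open>L\<close> embeds
    21-space isometrically into the triples of octonions, where \<open>weighted_isaacs\<close>
    applies.\<close>
  have "linear (oct_triple \<circ> L)" by (rule linear_compose[OF assms(5) linear_oct_triple])
  moreover have "norm ((oct_triple \<circ> L) y) = norm y" for y
    by (simp add: norm_oct_triple assms(6))
  moreover have "(\<lambda>y. P24 (L y) / norm (L y) powr \<delta>) = (\<lambda>y. octonion.weighted \<delta> ((oct_triple \<circ> L) y))"
    by (simp add: octonion.weighted_def cubic_oct_triple norm_oct_triple)
  ultimately show ?thesis
    using octonion.weighted_isaacs[OF assms(1,2), of "oct_triple \<circ> L" "ball 0 1"] by simp
qed

end
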